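(* Let $d\ge3$ and let $C$ be a $d$-dimensional Archimedean copula with generator $\psi$ and Williamson measure $\gamma$. Then: (1) if $\gamma$ is absolutely continuous then $\mu_C^{abs}(\mathbb{I}^d)=1$, i.e. $C$ is absolutely continuous; (2) if $\gamma$ is discrete then $\mu_C^{dis}(\mathbb{I}^d)=1$; (3) if $\gamma$ is singular (with respect to Lebesgue measure) without point masses then $\mu_C^{sing}(\mathbb{I}^d)=1$.
   Context: $\mathbb{I}=[0,1]$. An Archimedean generator is a continuous non-increasing $\psi:[0,\infty)\to\mathbb{I}$ with $\psi(0)=1$, $\lim_{z\to\infty}\psi(z)=0$, strictly decreasing on $[0,\inf\{z:\psi(z)=0\}]$, normalized by $\psi(1)=1/2$; pseudo-inverse $\varphi$. $C(\mathbf{u})=\psi(\sum_{i=1}^d\varphi(u_i))$ is a copula iff $(-1)^{d-2}\psi^{(d-2)}$ exists on $(0,\infty)$ and is non-negative, non-increasing and convex. The Williamson measure of $\psi$ is the unique probability measure $\gamma$ on $\mathcal{B}([0,\infty))$ with $\gamma(\{0\})=0$ and $\psi(z)=\int(1-tz)_+^{d-1}d\gamma(t)$ for $z>0$. $C^{1:d-1}(\mathbf{x})=C(\mathbf{x},1)$ is absolutely continuous with density $c^{1:d-1}$. Let $K_C$ be the $(d-1)$-Markov kernel of $C$ (regular conditional distribution of the last coordinate given the first $d-1$) and decompose $K_C(\mathbf{x},\cdot)=K_C^{dis}(\mathbf{x},\cdot)+K_C^{sing}(\mathbf{x},\cdot)+K_C^{abs}(\mathbf{x},\cdot)$ into sub-Markov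 kernels with $K_C^{dis}(\mathbf{x},\cdot)$ discrete, $K_C^{sing}(\mathbf{x},\cdot)$ singular without point masses and $K_C^{abs}(\mathbf{x},\cdot)$ absolutely continuous. For $\star\in\{dis,sing,abs\}$ define $\mu_C^\star(G)=\int_{\mathbb{I}^{d-1}}K_C^\star(\mathbf{x},G_\mathbf{x})c^{1:d-1}(\mathbf{x})\,d\lambda_{d-1}(\mathbf{x})$ for Borel $G\subseteq\mathbb{I}^d$, where $G_\mathbf{x}=\{y:(\mathbf{x},y)\in G\}$. *)

theory Defs
  imports "HOL-Probability.Probability"
begin

text \<open>Archimedean generator, normalized by psi 1 = 1/2. The interval on which psi must be
  strictly decreasing is [0, inf{z. psi z = 0}] (all of [0,oo) if psi has no zero).\<close>
definition arch_generator :: "(real \<Rightarrow> real) \<Rightarrow> bool" where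
  "arch_generator \<psi> \<longleftrightarrow>
     continuous_on {0..} \<psi> \<and>
     (\<forall>z\<ge>0. 0 \<le> \<psi> z \<and> \<psi> z \<le> 1) \<and>
     (\<forall>a b. 0 \<le> a \<and> a \<le> b \<longrightarrow> \<psi> b \<le> \<psi> a) \<and>
     \<psi> 0 = 1 \<and> (\<psi> \<longlongrightarrow> 0) at_top \<and>
     (\<forall>a b. 0 \<le> a \<and> a < b \<and> (\<forall>z. 0 \<le> z \<and> \<psi> z = 0 \<longrightarrow> b \<le> z) \<longrightarrow> \<psi> b < \<psi> a) \<and>
     \<psi> 1 = 1/2"

text \<open>Pseudo-inverse, with values in [0,oo]: gen_pinv psi 0 = inf{z. psi z = 0}, = oo if empty.\<close>
definition gen_pinv :: "(real \<Rightarrow> real) \<Rightarrow> real \<Rightarrow> ereal" where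
  "gen_pinv \<psi> t = Inf {ereal z | z. 0 \<le> z \<and> \<psi> z = t}"

definition gen_ext :: "(real \<Rightarrow> real) \<Rightarrow> ereal \<Rightarrow> real" where
  "gen_ext \<psi> s = (if s = \<infinity> then 0 else \<psi> (real_of_ereal s))"

definition arch_copula :: "nat \<Rightarrow> (real \<Rightarrow> real) \<Rightarrow> (nat \<Rightarrow> real) \<Rightarrow> real" where
  "arch_copula d \<psi> u = gen_ext \<psi> (\<Sum>i<d. gen_pinv \<psi> (u i))"

definition unit_cube :: "nat \<Rightarrow> (nat \<Rightarrow> real) set" where
  "unit_cube n = PiE {..<n} (\<lambda>_. {0..1})"

definition copula_measure_of :: "nat \<Rightarrow> ((nat \<Rightarrow> real) \<Rightarrow> real) \<Rightarrow> (nat \<Rightarrow> real) measure \<Rightarrow> bool" where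
  "copula_measure_of d C \<mu> \<longleftrightarrow>
     prob_space \<mu> \<and> sets \<mu> = sets (Pi\<^sub>M {..<d} (\<lambda>_. lborel)) \<and>
     (\<forall>u \<in> unit_cube d. measure \<mu> (PiE {..<d} (\<lambda>i. {0..u i})) = C u)"

definition williamson_measure :: "nat \<Rightarrow> (real \<Rightarrow> real) \<Rightarrow> real measure \<Rightarrow> bool" where
  "williamson_measure d \<psi> \<gamma> \<longleftrightarrow>
     prob_space \<gamma> \<and> sets \<gamma> = sets borel \<and>
     emeasure \<gamma> {..<0} = 0 \<and> emeasure \<gamma> {0} = 0 \<and>
     (\<forall>z>0. \<psi> z = (\<integral>t. (max 0 (1 - t * z)) ^ (d - 1) \<partial>\<gamma>))"

definition discrete_measure :: "real measure \<Rightarrow> bool" where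
  "discrete_measure N \<longleftrightarrow> (\<exists>S. countable S \<and> emeasure N (UNIV - S) = 0)"

definition singular_no_atoms :: "real measure \<Rightarrow> bool" where
  "singular_no_atoms N \<longleftrightarrow>
     (\<exists>Z \<in> sets borel. emeasure lborel Z = 0 \<and> emeasure N (UNIV - Z) = 0) \<and>
     (\<forall>t. emeasure N {t} = 0)"

definition abs_cont_measure :: "real measure \<Rightarrow> bool" where
  "abs_cont_measure N \<longleftrightarrow> absolutely_continuous lborel N"

definition markov_kernel_of :: "nat \<Rightarrow> (nat \<Rightarrow> real) measure \<Rightarrow> ((nat \<Rightarrow> real) \<Rightarrow> real measure) \<Rightarrow> bool" where
  "markov_kernel_of d \<mu> K \<longleftrightarrow>
     K \<in> measurable (Pi\<^sub>M {..<d-1} (\<lambda>_. lborel)) (prob_algebra borel) \<and>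
     (\<forall>A \<in> sets (Pi\<^sub>M {..<d-1} (\<lambda>_. lborel)). \<forall>B \<in> sets borel.
        emeasure \<mu> {z \<in> space \<mu>. restrict z {..<d-1} \<in> A \<and> z (d-1) \<in> B} =
        (\<integral>\<^sup>+x\<in>A. emeasure (K x) B
            \<partial>(distr \<mu> (Pi\<^sub>M {..<d-1} (\<lambda>_. lborel)) (\<lambda>z. restrict z {..<d-1}))))"

definition kernel_decomposition ::
  "nat \<Rightarrow> ((nat \<Rightarrow> real) \<Rightarrow> real measure) \<Rightarrow> ((nat \<Rightarrow> real) \<Rightarrow> real measure) \<Rightarrow>
   ((nat \<Rightarrow> real) \<Rightarrow> real measure) \<Rightarrow> ((nat \<Rightarrow> real) \<Rightarrow> real measure) \<Rightarrow> bool" where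
  "kernel_decomposition d K Kdis Ksing Kabs \<longleftrightarrow>
     Kdis \<in> measurable (Pi\<^sub>M {..<d-1} (\<lambda>_. lborel)) (subprob_algebra borel) \<and>
     Ksing \<in> measurable (Pi\<^sub>M {..<d-1} (\<lambda>_. lborel)) (subprob_algebra borel) \<and>
     Kabs \<in> measurable (Pi\<^sub>M {..<d-1} (\<lambda>_. lborel)) (subprob_algebra borel) \<and>
     (\<forall>x. \<forall>B \<in> sets borel.
        emeasure (K x) B = emeasure (Kdis x) B + emeasure (Ksing x) B + emeasure (Kabs x) B) \<and>
     (\<forall>x. discrete_measure (Kdis x)) \<and>
     (\<forall>x. singular_no_atoms (Ksing x)) \<and>
     (\<forall>x. abs_cont_measure (Kabs x))"

definition mu_part :: "nat \<Rightarrow> ((nat \<Rightarrow> real) \<Rightarrow> real measure) \<Rightarrow> ((nat \<Rightarrow> real) \<Rightarrow> real) \<Rightarrow>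
     (nat \<Rightarrow> real) set \<Rightarrow> ennreal" where
  "mu_part d K' c G =
     (\<integral>\<^sup>+x \<in> unit_cube (d-1). emeasure (K' x) {y. x(d-1 := y) \<in> G} * ennreal (c x)
        \<partial>(Pi\<^sub>M {..<d-1} (\<lambda>_. lborel)))"

end

theory Submission
  imports Defs
begin

text \<open>Write \<open>n = d - 1\<close>. If t has law \<open>\<gamma>\<close> and S is uniform on the unit simplex, the vector
  \<open>\<psi> (S\<^sub>i / t)\<close> has distribution function C, and the inverse generators of its coordinates sum
  to 1/t. Given the first n coordinates, the last one is therefore \<open>\<psi> (1/t - s)\<close> with s determined
  by these coordinates and the conditional law of t equivalent to a restriction of \<open>\<gamma>\<close>. Both \<open>\<psi>\<close>
  and its inverse are injective and, by convexity, locally Lipschitz where it matters, so the type of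
  \<open>\<gamma>\<close> is inherited by the kernel.

  A set of the form \<open>{u. 1 / (\<phi> u\<^sub>0 + \<dots> + \<phi> u\<^sub>n) \<in> Z}\<close> with \<open>\<gamma>\<close> concentrated on Z carries all of the
  mass of C and has countable (null) sections if Z is countable (null); if \<open>\<gamma>\<close> has no atoms, sets with
  countable sections are null for C, which removes the discrete part. In the absolutely continuous
  case, C has a density, and the kernel is computed from it almost everywhere.\<close>

subsection \<open>Volumes, null sets and uniqueness of measures\<close>

text \<open>\<open>K\<close> is an arbitrary version of the kernel and its three parts are known
  only by their types, so no explicit kernel formula is compared with them. Instead, two of the
  parts are shown to vanish for almost every condition; the third then carries the whole mass. Sets
  act on the kernel through their sections. This also handles the atoms of a part \<open>L\<close>,
  because the set of all (x, y) with \<open>L x {y} \<noteq> 0\<close> is jointly measurable. The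
  null set carrying a singular part may depend on x in a non-measurable way, so for absolutely
  continuous \<gamma> it cannot be assembled into one set; there almost every \<open>K x\<close> has
  to ignore all null sets at once. Convexity does not bound the slope of \<psi> at 0, so the value y
  = 1 is split off before a null set is mapped by \<psi>.\<close>

lemma emeasure_shifted_simplex:
  fixes a :: "'i \<Rightarrow> real" and J :: "'i \<Rightarrow> real set"
  assumes "finite I" and [measurable]: "\<And>i. J i \<in> sets borel"
    and J: "\<And>i. {a i<..} \<subseteq> J i" "\<And>i. J i \<subseteq> {a i..}"
  shows "emeasure (Pi\<^sub>M I (\<lambda>_. lborel)) {x \<in> space (Pi\<^sub>M I (\<lambda>_. lborel)). (\<forall>i\<in>I. x i \<in> J i) \<and> sum x I \<le> r}
    = ennreal (if sum a I \<le> r then (r - sum a I) ^ card I / fact (card I) else 0)"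
  using assms(1)
proof (induction I arbitrary: r rule: finite_induct)
  case empty
  then show ?case by (simp add: PiM_empty)
next
  case (insert b I)
  define S where "S I r = {x \<in> space (Pi\<^sub>M I (\<lambda>_. lborel)). (\<forall>i\<in>I. x i \<in> J i) \<and> sum x I \<le> r}" for I r
  have meas[measurable]: "S I r \<in> sets (Pi\<^sub>M I (\<lambda>_. lborel))" if "finite I" for I r
    unfolding S_def using that by measurable
  interpret product_sigma_finite "\<lambda>_::'i. lborel :: real measure" by standard
  let ?k = "card I"
  let ?s = "sum a I"
  let ?c = "\<lambda>y. y - ?s"
  \<comment> \<open>Slicing at \<open>x b = y\<close> leaves the same kind of set in one dimension
    less with bound \<open>r - y\<close>; this is why r varies in the induction.\<close>
  have step: "indicator (S (insert b I) r) (x(b := y)) = (indicator (J b) y * indicator (S I (r - y)) x :: ennreal)"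
    if "x \<in> space (Pi\<^sub>M I (\<lambda>_. lborel))" for x y
  proof -
    have "sum (x(b := y)) (insert b I) = y + sum x I"
      using insert.hyps by (subst sum.insert) (auto intro!: sum.cong)
    moreover have "(\<forall>i\<in>insert b I. (x(b := y)) i \<in> J i) \<longleftrightarrow> y \<in> J b \<and> (\<forall>i\<in>I. x i \<in> J i)"
      using insert.hyps by auto
    moreover have "x(b := y) \<in> space (Pi\<^sub>M (insert b I) (\<lambda>_. lborel))"
      using that by (auto simp: space_PiM PiE_def extensional_def)
    ultimately have "x(b := y) \<in> S (insert b I) r \<longleftrightarrow> y \<in> J b \<and> x \<in> S I (r - y)"
      unfolding S_def mem_Collect_eq using that by (simp add: algebra_simps)
    then show ?thesis by (simp add: indicator_def)
  qed
  have "emeasure (Pi\<^sub>M (insert b I) (\<lambda>_. lborel)) (S (insert b I) r)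
      = (\<integral>\<^sup>+y. \<integral>\<^sup>+x. indicator (S (insert b I) r) (x(b := y)) \<partial>Pi\<^sub>M I (\<lambda>_. lborel) \<partial>lborel)"
    using insert.hyps by (subst product_nn_integral_insert_rev[symmetric]) auto
  also have "\<dots> = (\<integral>\<^sup>+y. \<integral>\<^sup>+x. indicator (J b) y * indicator (S I (r - y)) x \<partial>Pi\<^sub>M I (\<lambda>_. lborel) \<partial>lborel)"
    by (intro nn_integral_cong) (simp add: step)
  also have "\<dots> = (\<integral>\<^sup>+y. indicator (J b) y * emeasure (Pi\<^sub>M I (\<lambda>_. lborel)) (S I (r - y)) \<partial>lborel)"
    using insert.hyps by (intro nn_integral_cong) (simp add: nn_integral_cmult_indicator)
  also have "\<dots> = (\<integral>\<^sup>+y. indicator (J b) y * ennreal (if ?s \<le> r - y then (r - y - ?s) ^ ?k / fact ?k else 0) \<partial>lborel)"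
    using insert.IH by (intro nn_integral_cong) (simp add: S_def)
  also have "\<dots> = (\<integral>\<^sup>+y\<in>{a b..r - ?s}. ennreal ((r - ?s - y) ^ ?k / fact ?k) \<partial>lborel)"
  \<comment> \<open>Whether \<open>J b\<close> contains its endpoint \<open>a b\<close> is left
    open; a single point does not affect the integral.\<close>
  proof (intro nn_integral_cong_AE eventually_mono[OF AE_lborel_singleton[of "a b"]])
    fix y assume "y \<noteq> a b"
    then have "y \<in> J b \<longleftrightarrow> a b \<le> y" using J[of b] by force
    then show "indicator (J b) y * ennreal (if ?s \<le> r - y then (r - y - ?s) ^ ?k / fact ?k else 0)
        = ennreal ((r - ?s - y) ^ ?k / fact ?k) * indicator {a b..r - ?s} y"
      by (auto simp: indicator_def algebra_simps)
  qed
  also have "\<dots> = ennreal (if a b + ?s \<le> r then (r - ?s - a b) ^ Suc ?k / fact (Suc ?k) else 0)"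
  proof (cases "a b \<le> r - ?s")
    case True
    define m where "m = Suc ?k"
    have "((\<lambda>x. - ((r - ?s - x) ^ m / fact m)) has_real_derivative real m * (r - ?s - x) ^ (m - 1) / fact m) (at x)" for x
      by (auto intro!: derivative_eq_intros)
    moreover have "real m * z / fact m = z / fact ?k" for z
      by (simp add: m_def divide_simps del: of_nat_Suc)
    ultimately have "((\<lambda>x. - ((r - ?s - x) ^ Suc ?k / fact (Suc ?k))) has_real_derivative (r - ?s - x) ^ ?k / fact ?k) (at x)" for x
      unfolding m_def diff_Suc_1 by simp
    then have "(\<integral>\<^sup>+y\<in>{a b..r - ?s}. ennreal ((r - ?s - y) ^ ?k / fact ?k) \<partial>lborel)
       = ennreal (- ((r - ?s - (r - ?s)) ^ Suc ?k / fact (Suc ?k)) - (- ((r - ?s - a b) ^ Suc ?k / fact (Suc ?k))))"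
      using True by (intro nn_integral_FTC_Icc) auto
    with True show ?thesis by (simp add: algebra_simps)
  qed auto
  also have "\<dots> = ennreal (if sum a (insert b I) \<le> r then (r - sum a (insert b I)) ^ card (insert b I) / fact (card (insert b I)) else 0)"
    using insert.hyps by (simp add: algebra_simps)
  finally show ?case unfolding S_def .
qed

lemma negligible_inverse_image:
  fixes N :: "real set"
  assumes "negligible N" "0 \<notin> N"
  shows "negligible (inverse ` N)"
proof (rule negligible_differentiable_image_negligible[OF _ assms(1)])
  show "inverse differentiable_on N"
    using assms(2) by (auto simp: differentiable_on_def intro!: differentiable_inverse derivative_intros)
qed simp

lemma null_sets_lborel_if_negligible:
  "negligible N \<Longrightarrow> N \<in> sets borel \<Longrightarrow> N \<in> null_sets lborel"
  by (simp add: negligible_iff_null_sets null_sets_completion_iff)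

text \<open>The positive part is convex, and powers are increasing and convex on the nonnegative
  reals. It is applied to the integrand of the Williamson transform.\<close>

lemma convex_max_power:
  fixes p q u :: real
  assumes "0 \<le> u" "u \<le> 1"
  shows "max 0 ((1 - u) * p + u * q) ^ n \<le> (1 - u) * max 0 p ^ n + u * max 0 q ^ n"
proof -
  have "max 0 ((1 - u) * p + u * q) \<le> (1 - u) * max 0 p + u * max 0 q"
    using assms by (auto intro!: add_mono mult_left_mono)
  then have "max 0 ((1 - u) * p + u * q) ^ n \<le> ((1 - u) * max 0 p + u * max 0 q) ^ n"
    by (intro power_mono) auto
  also have "\<dots> \<le> (1 - u) * max 0 p ^ n + u * max 0 q ^ n"
  \<comment> \<open>Odd powers are convex only on the nonnegative half-line, which suffices for
    positive parts.\<close>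
  proof (cases "even n")
    case True
    show ?thesis using convex_onD[OF convex_power_even[OF True], of u "max 0 p" "max 0 q"] assms by simp
  next
    case False
    then have "odd n" .
    show ?thesis using convex_onD[OF convex_power_odd[OF \<open>odd n\<close>], of u "max 0 p" "max 0 q"] assms by simp
  qed
  finally show ?thesis .
qed

text \<open>Lower orthants are stable under intersection and generate the product sigma-algebra, so
  a multivariate distribution function determines its measure.\<close>

lemma measure_eqI_PiM_atMost:
  fixes M N :: "('i \<Rightarrow> real) measure"
  assumes I: "finite I" and sM: "sets M = sets (Pi\<^sub>M I (\<lambda>_. lborel))" and sN: "sets N = sets (Pi\<^sub>M I (\<lambda>_. lborel))"
    and fin: "finite_measure M"
    and eq: "\<And>u. emeasure M (PiE I (\<lambda>i. {..u i})) = emeasure N (PiE I (\<lambda>i. {..u i}))"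
  shows "M = N"
proof -
  let ?E = "{PiE I F | F. \<forall>i\<in>I. F i \<in> range (atMost :: real \<Rightarrow> real set)}"
  have gen: "sets (Pi\<^sub>M I (\<lambda>_::'i. lborel :: real measure)) = sigma_sets (space (Pi\<^sub>M I (\<lambda>_. lborel))) ?E"
  proof -
    have "sets (Pi\<^sub>M I (\<lambda>_::'i. lborel :: real measure)) = sets (\<Pi>\<^sub>M i\<in>I. sigma UNIV (range (atMost :: real \<Rightarrow> real set)))"
      by (intro sets_PiM_cong) (simp_all add: borel_eq_atMost)
    \<comment> \<open>Constraining every coordinate at once (\<open>j = I\<close>) is enough, since
      the line is a countable union of rays.\<close>
    also have "\<dots> = sets (sigma (\<Pi>\<^sub>E i\<in>I. UNIV) {{f \<in> (\<Pi>\<^sub>E i\<in>I. UNIV). \<forall>i\<in>j. f i \<in> A i} | A j. j \<in> {I} \<and> A \<in> Pi j (\<lambda>_. range atMost)})"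
    proof (rule sets_PiM_sigma)
      have "UNIV = \<Union> (range (\<lambda>k. {..real k}))" by (auto simp: real_arch_simple)
      then show "\<exists>S\<subseteq>range (atMost :: real \<Rightarrow> real set). countable S \<and> UNIV = \<Union> S"
        by (intro exI[of _ "range (\<lambda>k. {..real k})"]) auto
    qed (use I in auto)
    also have "{{f \<in> (\<Pi>\<^sub>E i\<in>I. UNIV). \<forall>i\<in>j. f i \<in> A i} | A j. j \<in> {I} \<and> A \<in> Pi j (\<lambda>_. range atMost)} = ?E"
    proof -
      have "{f \<in> (\<Pi>\<^sub>E i\<in>I. UNIV). \<forall>i\<in>I. f i \<in> A i} = PiE I A" for A :: "'i \<Rightarrow> real set"
        by (auto simp: PiE_iff extensional_def)
      then show ?thesis by (auto simp: Pi_iff)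
    qed
    also have "sets (sigma (\<Pi>\<^sub>E i\<in>I. UNIV) ?E) = sigma_sets (\<Pi>\<^sub>E i\<in>I. UNIV) ?E"
      by (intro sets_measure_of) auto
    finally show ?thesis by (simp add: space_PiM)
  qed
  show ?thesis
  proof (rule measure_eqI_generator_eq)
    show "Int_stable ?E"
      unfolding Int_stable_def
    proof safe
      fix F G :: "'i \<Rightarrow> real set"
      assume "\<forall>i\<in>I. F i \<in> range atMost" "\<forall>i\<in>I. G i \<in> range atMost"
      then have "\<forall>i\<in>I. F i \<inter> G i \<in> range atMost" by (force simp: Int_atMost)
      then show "\<exists>H. PiE I F \<inter> PiE I G = PiE I H \<and> (\<forall>i\<in>I. H i \<in> range atMost)"
        by (intro exI[of _ "\<lambda>i. F i \<inter> G i"]) (simp add: PiE_Int)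
    qed
    show "?E \<subseteq> Pow (space (Pi\<^sub>M I (\<lambda>_. lborel)))" by (auto simp: space_PiM)
    show "sets M = sigma_sets (space (Pi\<^sub>M I (\<lambda>_. lborel))) ?E" using sM gen by simp
    show "sets N = sigma_sets (space (Pi\<^sub>M I (\<lambda>_. lborel))) ?E" using sN gen by simp
    show "range (\<lambda>k. PiE I (\<lambda>_. {..real k})) \<subseteq> ?E" by auto
    show "(\<Union>k. PiE I (\<lambda>_. {..real k})) = space (Pi\<^sub>M I (\<lambda>_. lborel))"
    proof (intro equalityI subsetI)
      fix x :: "'i \<Rightarrow> real" assume x: "x \<in> space (Pi\<^sub>M I (\<lambda>_. lborel))"
      obtain k where k: "Max (insert 0 (x ` I)) \<le> real k" using real_arch_simple by blast
      then have "x i \<le> real k" if "i \<in> I" for i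
        using Max_ge[of "insert 0 (x ` I)" "x i"] that I by auto
      then show "x \<in> (\<Union>k. PiE I (\<lambda>_. {..real k}))" using x by (auto simp: space_PiM PiE_iff)
    qed (auto simp: space_PiM PiE_iff)
    show "emeasure M (PiE I (\<lambda>_. {..real k})) \<noteq> \<infinity>" for k
      using finite_measure.emeasure_finite[OF fin] by simp
    fix X assume "X \<in> ?E"
    then obtain F where F: "X = PiE I F" "\<forall>i\<in>I. \<exists>u. F i = {..u}" by (auto simp: image_iff)
    then obtain u where "\<forall>i\<in>I. F i = {..u i}" by metis
    then have "X = PiE I (\<lambda>i. {..u i})" using F by (auto intro!: PiE_cong)
    then show "emeasure M X = emeasure N X" using eq by simp
  qed
qed

lemma emeasure_countable_eq_0:
  fixes N :: "real measure"
  assumes "sets N = sets borel" "countable S" "\<And>y. y \<in> S \<Longrightarrow> emeasure N {y} = 0"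
  shows "emeasure N S = 0"
proof -
  have "(\<Union>y\<in>S. {y}) \<in> null_sets N"
    using assms by (intro null_sets_UN') (auto simp: null_sets_def)
  then show ?thesis by auto
qed

text \<open>A countable generator is wanted: identities that hold for almost every x, one for each
  generating set, then hold simultaneously for almost every x.\<close>

lemma sets_borel_rat_greaterThan:
  "sets borel = sigma_sets UNIV (range (\<lambda>q :: rat. {real_of_rat q <..}))"
proof -
  have "borel = sigma UNIV (range (\<lambda>q :: rat. {real_of_rat q <..}))"
  proof (rule borel_eq_sigmaI1[OF borel_Ioi])
    fix X :: "real set" assume "X \<in> range greaterThan"
    then obtain x where X: "X = {x<..}" by auto
    have "X = (\<Union>q\<in>{q. x < real_of_rat q}. {real_of_rat q <..})"
      using of_rat_dense[of x] by (auto simp: X intro: less_trans)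
    moreover have "(\<Union>q\<in>{q. x < real_of_rat q}. {real_of_rat q <..}) \<in> sets (sigma UNIV (range (\<lambda>q :: rat. {real_of_rat q <..})))"
      by (intro sets.countable_UN' countableI_type) (auto intro!: sigma_sets.Basic)
    ultimately show "X \<in> sets (sigma UNIV (range (\<lambda>q :: rat. {real_of_rat q <..})))"
      by simp
  qed simp
  then show ?thesis by (metis sets_measure_of subset_UNIV Pow_UNIV)
qed

lemma measure_eqI_rat_greaterThan:
  fixes M N :: "real measure"
  assumes "sets M = sets borel" "sets N = sets borel" "emeasure M UNIV \<noteq> \<infinity>"
    and eq: "\<And>q. emeasure M {real_of_rat q <..} = emeasure N {real_of_rat q <..}"
  shows "M = N"
proof (rule measure_eqI_generator_eq)
  let ?E = "range (\<lambda>q :: rat. {real_of_rat q <..})"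
  show "Int_stable ?E"
    unfolding Int_stable_def
  proof safe
    fix p q :: rat
    have "{real_of_rat p <..} \<inter> {real_of_rat q <..} = {real_of_rat (max p q) <..}"
    proof -
      have "real_of_rat (max p q) = max (real_of_rat p) (real_of_rat q)"
        by (simp add: max_def of_rat_less_eq)
      then show ?thesis by auto
    qed
    then show "{real_of_rat p <..} \<inter> {real_of_rat q <..} \<in> ?E" by simp
  qed
  show "range (\<lambda>k :: nat. {real_of_rat (- of_nat k) <..}) \<subseteq> ?E" by blast
  show "(\<Union>k :: nat. {real_of_rat (- of_nat k) <..}) = UNIV"
  proof (intro equalityI subsetI)
    fix x :: real
    obtain k :: nat where "- x < real k" using reals_Archimedean2 by blast
    then show "x \<in> (\<Union>k :: nat. {real_of_rat (- of_nat k) <..})"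
      by (auto simp: of_rat_minus intro!: exI[of _ k])
  qed simp
  show "emeasure M {real_of_rat (- of_nat k) <..} \<noteq> \<infinity>" for k
    using emeasure_mono[of "{real_of_rat (- of_nat k) <..}" UNIV M] assms(1,3)
    by (auto simp: top_unique)
  show "sets M = sigma_sets UNIV ?E" "sets N = sigma_sets UNIV ?E"
    unfolding assms(1,2) by (rule sets_borel_rat_greaterThan)+
  fix X assume "X \<in> ?E"
  then show "emeasure M X = emeasure N X" using eq by blast
qed blast

text \<open>The unspecified countable carrier is replaced by the set of atoms. For a kernel this set
  depends measurably on the argument, which an arbitrary choice of carriers would not
  guarantee.\<close>

lemma discrete_measure_support:
  fixes N :: "real measure"
  assumes N: "discrete_measure N" "sets N = sets borel" "finite_measure N"
  shows "countable {y. emeasure N {y} \<noteq> 0}" "emeasure N (UNIV - {y. emeasure N {y} \<noteq> 0}) = 0"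
proof -
  interpret finite_measure N by fact
  let ?P = "{y. emeasure N {y} \<noteq> 0}"
  show P: "countable ?P"
    using countable_support by (simp add: emeasure_eq_measure)
  obtain S where S: "countable S" "emeasure N (UNIV - S) = 0"
    using N(1) by (auto simp: discrete_measure_def)
  have [measurable]: "A \<in> sets N" if "countable A" for A
    unfolding N(2) by (rule sets.countable[OF _ that]) simp
  have [simp]: "countable (S - ?P)" using S(1) by auto
  have [simp]: "UNIV \<in> sets N" by (simp add: N(2))
  have "emeasure N (UNIV - ?P) \<le> emeasure N ((UNIV - S) \<union> (S - ?P))"
    using S(1) P by (intro emeasure_mono sets.Un sets.Diff) auto
  also have "\<dots> \<le> emeasure N (UNIV - S) + emeasure N (S - ?P)"
    using S(1) P by (intro emeasure_subadditive sets.Diff) auto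
  also have "emeasure N (S - ?P) = 0"
    by (rule emeasure_countable_eq_0[OF N(2)]) auto
  finally show "emeasure N (UNIV - ?P) = 0" using S by simp
qed

lemma negligible_if_countable:
  fixes S :: "real set"
  shows "countable S \<Longrightarrow> negligible S"
  by (simp add: negligible_iff_null_sets countable_imp_null_set_lborel null_sets_completionI)

lemma singular_countable_0:
  "singular_no_atoms N \<Longrightarrow> sets N = sets borel \<Longrightarrow> countable S \<Longrightarrow> emeasure N S = 0"
  by (rule emeasure_countable_eq_0) (auto simp: singular_no_atoms_def)

lemma abs_cont_negligible_0:
  assumes "abs_cont_measure N" "negligible S" "S \<in> sets borel"
  shows "emeasure N S = 0"
  using assms null_sets_lborel_if_negligible[OF assms(2,3)]
  by (auto simp: abs_cont_measure_def absolutely_continuous_def)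

lemma emeasure_UNIV_eq_0:
  assumes "sets N = sets borel" "S \<in> sets borel" "emeasure N S = 0" "emeasure N (UNIV - S) = 0"
  shows "emeasure N UNIV = 0"
proof -
  have "S \<union> (UNIV - S) \<in> null_sets N"
    using assms by (intro null_sets.Un) (auto simp: null_sets_def)
  then show ?thesis by (simp add: null_sets_def)
qed

subsection \<open>The generator and its inverse\<close>

text \<open>\<open>n\<close> is the dimension minus one: the exponent of the Williamson transform
  and the number of conditioning coordinates. \<open>2 \<le> n\<close> renders
  \<open>d \<ge> 3\<close>.\<close>

locale williamson_generator =
  fixes n :: nat and \<psi> :: "real \<Rightarrow> real" and \<gamma> :: "real measure"
  assumes n: "2 \<le> n"
    and gen: "arch_generator \<psi>"
    and will: "williamson_measure (Suc n) \<psi> \<gamma>"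
begin

sublocale \<gamma>: prob_space \<gamma>
  using will by (simp add: williamson_measure_def)

lemma sets_\<gamma>[measurable_cong, simp]: "sets \<gamma> = sets borel"
  using will by (simp add: williamson_measure_def)

lemma space_\<gamma>[simp]: "space \<gamma> = UNIV"
  using sets_eq_imp_space_eq[OF sets_\<gamma>] by simp

lemma AE_\<gamma>_pos: "AE t in \<gamma>. 0 < t"
proof -
  have "{..<0} \<union> {0} \<in> null_sets \<gamma>"
    using will by (intro null_sets.Un) (auto simp: williamson_measure_def null_sets_def)
  from AE_not_in[OF this] show ?thesis by eventually_elim auto
qed

lemma psi_0[simp]: "\<psi> 0 = 1" and psi_antimono: "0 \<le> a \<Longrightarrow> a \<le> b \<Longrightarrow> \<psi> b \<le> \<psi> a"
  and psi_nonneg: "0 \<le> z \<Longrightarrow> 0 \<le> \<psi> z" and psi_le_1: "0 \<le> z \<Longrightarrow> \<psi> z \<le> 1"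
  and psi_lim: "(\<psi> \<longlongrightarrow> 0) at_top" and psi_cont: "continuous_on {0..} \<psi>"
  using gen by (auto simp: arch_generator_def)

text \<open>Strictness is granted only up to the first zero; if b lies beyond a zero, then \<psi> b
  is 0 while \<psi> a is still positive.\<close>

lemma psi_strict:
  assumes "0 \<le> a" "a < b" "0 < \<psi> a" shows "\<psi> b < \<psi> a"
proof (cases "\<forall>z. 0 \<le> z \<and> \<psi> z = 0 \<longrightarrow> b \<le> z")
  case True
  then show ?thesis using gen assms unfolding arch_generator_def by blast
next
  case False
  then obtain z where "0 \<le> z" "\<psi> z = 0" "z < b" by auto
  then show ?thesis using psi_antimono[of z b] assms by simp
qed

lemma psi_inj: "\<lbrakk>0 \<le> a; 0 \<le> b; \<psi> a = \<psi> b; 0 < \<psi> a\<rbrakk> \<Longrightarrow> a = b"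
  using psi_strict[of a b] psi_strict[of b a] by (cases a b rule: linorder_cases) auto

lemma integrable_kernel: "0 \<le> z \<Longrightarrow> integrable \<gamma> (\<lambda>t. max 0 (1 - t * z) ^ n)"
proof (rule \<gamma>.integrable_const_bound[where B = 1])
  assume z: "0 \<le> z"
  show "AE t in \<gamma>. norm (max 0 (1 - t * z) ^ n) \<le> 1"
    using AE_\<gamma>_pos by eventually_elim (use z in \<open>auto simp: power_le_one\<close>)
qed simp

lemma psi_eq: "0 \<le> z \<Longrightarrow> \<psi> z = (\<integral>t. max 0 (1 - t * z) ^ n \<partial>\<gamma>)"
  using will 
    \<gamma>.prob_space by (cases "z = 0") (auto simp: williamson_measure_def)

text \<open>\<psi> is a mixture over t of functions that are convex in z.\<close>

lemma psi_convex: "convex_on {0..} \<psi>"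
proof (rule convex_onI)
  fix u x y :: real assume u: "0 < u" "u < 1" and "x \<in> {0..}" "y \<in> {0..}"
  then have xy: "0 \<le> x" "0 \<le> y" by auto
  let ?z = "(1 - u) * x + u * y"
  have z: "0 \<le> ?z" using u xy by simp
  have "\<psi> ?z = (\<integral>t. max 0 (1 - t * ?z) ^ n \<partial>\<gamma>)" using z by (rule psi_eq)
  also have "\<dots> \<le> (\<integral>t. (1 - u) * max 0 (1 - t * x) ^ n + u * max 0 (1 - t * y) ^ n \<partial>\<gamma>)"
  proof (intro integral_mono)
    fix t
    have "1 - t * ?z = (1 - u) * (1 - t * x) + u * (1 - t * y)" by (simp add: algebra_simps)
    then show "max 0 (1 - t * ?z) ^ n \<le> (1 - u) * max 0 (1 - t * x) ^ n + u * max 0 (1 - t * y) ^ n"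
      using convex_max_power[of u "1 - t * x" "1 - t * y" n] u by simp
  qed (use z xy integrable_kernel in auto)
  also have "\<dots> = (1 - u) * \<psi> x + u * \<psi> y"
    using xy integrable_kernel by (simp add: psi_eq)
  finally show "\<psi> ((1 - u) *\<^sub>R x + u *\<^sub>R y) \<le> (1 - u) * \<psi> x + u * \<psi> y" by simp
qed simp

text \<open>If \<psi> has a first zero \<open>z0\<close>, attained by continuity, the vanishing
  integral at \<open>z0\<close> forces \<open>1 \<le> t * z0\<close> for almost every t. Hence every
  z with \<open>t * z < 1\<close> lies before \<open>z0\<close>.\<close>

lemma AE_\<gamma>_support: "AE t in \<gamma>. \<forall>z. 0 \<le> z \<longrightarrow> t * z < 1 \<longrightarrow> 0 < \<psi> z"
proof (cases "\<exists>z\<ge>0. \<psi> z = 0")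
  case True
  have "closed {z \<in> {0..}. \<psi> z = 0}"
    using continuous_closed_preimage[OF psi_cont, of "{0}"] by (simp add: vimage_def Int_def)
  moreover define z0 where "z0 = Inf {z \<in> {0..}. \<psi> z = 0}"
  ultimately have "z0 \<in> {z \<in> {0..}. \<psi> z = 0}"
    using True unfolding z0_def by (intro closed_contains_Inf) (auto intro!: bdd_belowI[of _ 0])
  then have z0: "0 \<le> z0" "\<psi> z0 = 0" by auto
  have least: "z0 \<le> z" if "0 \<le> z" "\<psi> z = 0" for z
    unfolding z0_def using that by (intro cInf_lower) (auto intro!: bdd_belowI[of _ 0])
  have "AE t in \<gamma>. max 0 (1 - t * z0) ^ n = 0"
    using psi_eq[OF z0(1)] z0 integrable_kernel[OF z0(1)]
    by (subst integral_nonneg_eq_0_iff_AE[symmetric]) auto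
  with AE_\<gamma>_pos show ?thesis
  proof eventually_elim
    case (elim t)
    then have "1 \<le> t * z0" by (auto simp: max_def split: if_splits)
    show ?case
    proof safe
      fix z assume z: "0 \<le> z" "t * z < 1"
      then have "t * z < t * z0" using \<open>1 \<le> t * z0\<close> by simp
      then have "z < z0" using elim by simp
      then show "0 < \<psi> z" using least[of z] psi_nonneg[OF z(1)] z by force
    qed
  qed
next
  case False
  then show ?thesis using psi_nonneg by (auto simp: less_le)
qed

text \<open>A real-valued substitute for \<open>gen_pinv \<psi>\<close> on (0,1], where the
  pseudo-inverse is finite. The default 0 elsewhere keeps it nonnegative and measurable.\<close>

definition \<phi> :: "real \<Rightarrow> real" where
  "\<phi> y = (if 0 < y \<and> y \<le> 1 then THE z. 0 \<le> z \<and> \<psi> z = y else 0)"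

lemma phi: assumes "0 < y" "y \<le> 1" shows "0 \<le> \<phi> y" "\<psi> (\<phi> y) = y"
proof -
  have "eventually (\<lambda>z. \<psi> z < y) at_top" using psi_lim assms by (intro order_tendstoD)
  then obtain b where "0 \<le> b" "\<psi> b < y"
    using eventually_conj[OF eventually_ge_at_top[of 0]] eventually_happens'[OF trivial_limit_at_top_linorder]
    by blast
  then obtain z where "0 \<le> z" "\<psi> z = y"
    using IVT2'[of \<psi> b y 0] assms continuous_on_subset[OF psi_cont] by force
  then have "\<exists>!z. 0 \<le> z \<and> \<psi> z = y" using psi_inj assms by (intro ex1I[of _ z]) auto
  from theI'[OF this] show "0 \<le> \<phi> y" "\<psi> (\<phi> y) = y" using assms by (auto simp: \<phi>_def)
qed

lemma phi_nonneg: "0 \<le> \<phi> y"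
  using phi by (cases "0 < y \<and> y \<le> 1") (auto simp: \<phi>_def)

lemma phi_psi: "0 \<le> z \<Longrightarrow> 0 < \<psi> z \<Longrightarrow> \<phi> (\<psi> z) = z"
  using phi[of "\<psi> z"] psi_inj[of "\<phi> (\<psi> z)" z] psi_le_1 by simp

text \<open>Turns upper bounds on copula coordinates into lower bounds on simplex coordinates. Only
  the level y has to be positive; z may lie beyond the first zero of \<psi>.\<close>

lemma psi_le_iff:
  assumes "0 < y" "y \<le> 1" "0 \<le> z" shows "\<psi> z \<le> y \<longleftrightarrow> \<phi> y \<le> z"
proof
  assume "\<psi> z \<le> y"
  show "\<phi> y \<le> z"
  proof (rule ccontr)
    assume "\<not> \<phi> y \<le> z"
    then have "\<psi> (\<phi> y) < \<psi> z"
      using psi_antimono[of z "\<phi> y"] assms phi[OF assms(1,2)] by (intro psi_strict) auto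
    with \<open>\<psi> z \<le> y\<close> phi(2)[OF assms(1,2)] show False by simp
  qed
next
  assume "\<phi> y \<le> z"
  then show "\<psi> z \<le> y" using phi[OF assms(1,2)] psi_antimono[of "\<phi> y" z] by simp
qed

lemma measurable_phi[measurable]: "\<phi> \<in> borel_measurable borel"
proof (rule borel_measurableI_le)
  fix a :: real
  have "{y. \<phi> y \<le> a} = (if a < 0 then {} else {..0} \<union> {1<..} \<union> {\<psi> a..})"
  proof (cases "a < 0")
    case False
    have "\<phi> y \<le> a \<longleftrightarrow> y \<in> {..0} \<union> {1<..} \<union> {\<psi> a..}" for y
    proof (cases "0 < y \<and> y \<le> 1")
      case True then show ?thesis using psi_le_iff[of y a] False by auto
    qed (use False in \<open>auto simp: \<phi>_def\<close>)
    with False show ?thesis by auto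
  qed (use phi_nonneg in \<open>auto simp: not_le intro: less_le_trans\<close>)
  then show "{y \<in> space borel. \<phi> y \<le> a} \<in> sets borel" by simp
qed

lemma gen_pinv_eq: "0 < y \<Longrightarrow> y \<le> 1 \<Longrightarrow> gen_pinv \<psi> y = ereal (\<phi> y)"
proof -
  assume y: "0 < y" "y \<le> 1"
  have "{ereal z | z. 0 \<le> z \<and> \<psi> z = y} = {ereal (\<phi> y)}"
  proof (intro equalityI subsetI)
    fix e assume "e \<in> {ereal z | z. 0 \<le> z \<and> \<psi> z = y}"
    then obtain z where "e = ereal z" "0 \<le> z" "\<psi> z = y" by auto
    then show "e \<in> {ereal (\<phi> y)}" using phi_psi[of z] y by simp
  qed (use phi[OF y] in auto)
  then show ?thesis by (simp add: gen_pinv_def)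
qed

lemma gen_pinv_nonneg: "0 \<le> gen_pinv \<psi> y"
  unfolding gen_pinv_def by (rule Inf_greatest) auto

text \<open>Needed for a copula argument with a zero coordinate, whose sum of inverses is at least
  the possibly infinite \<open>gen_pinv \<psi> 0\<close>.\<close>

lemma gen_ext_ge_gen_pinv_0:
  assumes "gen_pinv \<psi> 0 \<le> s" shows "gen_ext \<psi> s = 0"
proof (cases "s = \<infinity>")
  case False
  then have "gen_pinv \<psi> 0 \<noteq> \<infinity>" using assms by auto
  then have ne: "{z. 0 \<le> z \<and> \<psi> z = 0} \<noteq> {}" by (auto simp: gen_pinv_def top_ereal_def[symmetric])
  have s: "0 \<le> s" using gen_pinv_nonneg assms by (rule order_trans)
  with False obtain r where r: "s = ereal r" "0 \<le> r" by (cases s) auto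
  have "\<psi> r = 0"
  proof (rule ccontr)
    assume "\<psi> r \<noteq> 0"
    then have pos: "0 < \<psi> r" using psi_nonneg[OF r(2)] by simp
    \<comment> \<open>Half of the positive value is taken at a point strictly after r and not after
      any zero, so that \<open>gen_pinv \<psi> 0\<close> would exceed r.\<close>
    let ?y = "\<psi> r / 2"
    have y: "0 < ?y" "?y \<le> 1" using pos psi_le_1[OF r(2)] by auto
    have "r < \<phi> ?y" using psi_le_iff[OF y r(2)] pos by auto
    moreover have "ereal (\<phi> ?y) \<le> gen_pinv \<psi> 0"
      unfolding gen_pinv_def
    proof (rule Inf_greatest, safe)
      fix z assume "0 \<le> z" "\<psi> z = 0"
      then show "ereal (\<phi> ?y) \<le> ereal z" using psi_le_iff[OF y, of z] y by simp
    qed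
    ultimately have "ereal r < gen_pinv \<psi> 0" by (meson ereal_less_eq(3) less_ereal.simps(1) less_le_trans)
    with assms r show False by simp
  qed
  then show ?thesis using r by (simp add: gen_ext_def)
qed (simp add: gen_ext_def)

lemma arch_copula_pos:
  assumes "\<And>i. i < m \<Longrightarrow> 0 < u i \<and> u i \<le> 1"
  shows "arch_copula m \<psi> u = \<psi> (\<Sum>i<m. \<phi> (u i))"
proof -
  have "(\<Sum>i<m. gen_pinv \<psi> (u i)) = ereal (\<Sum>i<m. \<phi> (u i))"
    using assms by (subst sum_ereal[symmetric], intro sum.cong refl gen_pinv_eq) auto
  then show ?thesis by (simp add: arch_copula_def gen_ext_def)
qed

lemma arch_copula_0:
  assumes "i < m" "u i = 0"
  shows "arch_copula m \<psi> u = 0"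
  unfolding arch_copula_def
proof (rule gen_ext_ge_gen_pinv_0)
  show "gen_pinv \<psi> 0 \<le> (\<Sum>i<m. gen_pinv \<psi> (u i))"
    using assms sum_mono2[of "{..<m}" "{i}" "\<lambda>i. gen_pinv \<psi> (u i)"] gen_pinv_nonneg by simp
qed

text \<open>Convexity makes both the generator and its inverse locally Lipschitz, so neither of them
  can turn a null set into a non-null one.\<close>

lemma negligible_psi_image:
  assumes "negligible N" "N \<subseteq> {0<..}" shows "negligible (\<psi> ` N)"
proof (rule negligible_locally_Lipschitz_image[OF _ assms(1)])
  fix z assume "z \<in> N"
  then have z: "0 < z" using assms by auto
  \<comment> \<open>Any point between 0 and z would serve. By convexity no chord from z to a point
    right of w is steeper than the chord over [w, z], whose absolute slope is
    \<open>B\<close>.\<close>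
  define w where "w = z / 2"
  define B where "B = (\<psi> w - \<psi> z) / (z - w)"
  have w: "0 < w" "w < z" using z by (auto simp: w_def)
  have "norm (\<psi> y - \<psi> z) \<le> B * norm (y - z)" if y: "w < y" for y
  proof (cases y z rule: linorder_cases)
    case less
    have "(\<psi> w - \<psi> z) / (w - z) \<le> (\<psi> y - \<psi> z) / (y - z)"
      using convex_on_slope_le(2)[OF psi_convex, of w z y] less y w by simp
    then have "\<psi> y - \<psi> z \<le> B * (z - y)" using less w by (simp add: B_def field_simps)
    then show ?thesis using psi_antimono[of y z] less y w by simp
  next
    case greater
    have "(\<psi> w - \<psi> z) / (w - z) \<le> (\<psi> z - \<psi> y) / (z - y)"
      using convex_on_slope_le(1)[OF psi_convex, of w y z] convex_on_slope_le(2)[OF psi_convex, of w y z]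
        greater y w by simp
    then have "\<psi> z - \<psi> y \<le> B * (y - z)" using greater w by (simp add: B_def field_simps)
    then show ?thesis using psi_antimono[of z y] greater y w by simp
  qed simp
  then show "\<exists>T B. open T \<and> z \<in> T \<and> (\<forall>y\<in>N \<inter> T. norm (\<psi> y - \<psi> z) \<le> B * norm (y - z))"
    using w by (intro exI[of _ "{w<..}"] exI[of _ B]) auto
qed simp

lemma negligible_phi_image:
  assumes "negligible N" "N \<subseteq> {0<..<1}" shows "negligible (\<phi> ` N)"
proof (rule negligible_locally_Lipschitz_image[OF _ assms(1)])
  fix v assume "v \<in> N"
  then have v: "0 < v" "v < 1" using assms by auto
  define z where "z = \<phi> v"
  have z: "0 \<le> z" "\<psi> z = v" using phi v by (auto simp: z_def)
  \<comment> \<open>Any point right of z would serve. The chord over [z, b] descends with slope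
    \<open>m > 0\<close>, and by convexity chords from z to points left of b are at least as steep;
    the inverse thus has Lipschitz constant \<open>1 / m\<close> at v.\<close>
  define b where "b = z + 1"
  define m where "m = (\<psi> z - \<psi> b) / (b - z)"
  have b: "\<psi> b < v" using psi_strict[of z b] z v by (simp add: b_def)
  have m: "0 < m" using b z by (simp add: m_def b_def)
  have "norm (\<phi> y - \<phi> v) \<le> (1 / m) * norm (y - v)" if y: "y \<in> N" "\<psi> b < y" for y
  proof -
    have y': "0 < y" "y < 1" using y assms by auto
    define x where "x = \<phi> y"
    have x: "0 \<le> x" "\<psi> x = y" using phi y' by (auto simp: x_def)
    have "x < b" using psi_antimono[of b x] x y z by (force simp: b_def)
    have "m * \<bar>x - z\<bar> \<le> \<bar>\<psi> x - \<psi> z\<bar>"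
    proof (cases x z rule: linorder_cases)
      case less
      have "(\<psi> x - \<psi> z) / (x - z) \<le> (\<psi> z - \<psi> b) / (z - b)"
        using convex_on_slope_le(1)[OF psi_convex, of x b z] convex_on_slope_le(2)[OF psi_convex, of x b z]
          less x z by (simp add: b_def)
      then have "m * (z - x) \<le> \<psi> x - \<psi> z" using less by (simp add: m_def b_def field_simps)
      then show ?thesis using less by simp
    next
      case greater
      have "(\<psi> z - \<psi> x) / (z - x) \<le> (\<psi> z - \<psi> b) / (z - b)"
        using convex_on_slope_le(1)[OF psi_convex, of z b x] greater x z \<open>x < b\<close> by (simp add: b_def)
      then have "m * (x - z) \<le> \<psi> z - \<psi> x" using greater by (simp add: m_def b_def field_simps)
      then show ?thesis using greater by simp
    qed simp
    then show ?thesis using m x z by (simp add: x_def z_def field_simps)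
  qed
  then show "\<exists>T B. open T \<and> v \<in> T \<and> (\<forall>y\<in>N \<inter> T. norm (\<phi> y - \<phi> v) \<le> B * norm (y - v))"
    using b by (intro exI[of _ "{\<psi> b<..}"] exI[of _ "1 / m"]) auto
qed simp

subsection \<open>The stochastic representation of the copula\<close>

abbreviation lam :: "(nat \<Rightarrow> real) measure" where "lam \<equiv> Pi\<^sub>M {..<n} (\<lambda>_. lborel)"

text \<open>Nothing is assumed about \<open>\<psi>\<close> on negative arguments, not even measurability.\<close>
definition \<psi>\<^sub>0 :: "real \<Rightarrow> real" where "\<psi>\<^sub>0 z = \<psi> (max 0 z)"

lemma psi0_eq: "0 \<le> z \<Longrightarrow> \<psi>\<^sub>0 z = \<psi> z" by (simp add: \<psi>\<^sub>0_def max_def)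

lemma measurable_psi0[measurable]: "\<psi>\<^sub>0 \<in> borel_measurable borel"
proof (rule borel_measurable_continuous_onI)
  show "continuous_on UNIV \<psi>\<^sub>0"
    unfolding \<psi>\<^sub>0_def by (rule continuous_on_compose2[OF psi_cont]) (auto intro!: continuous_intros)
qed

text \<open>The last condition says that the remaining coordinate
  \<open>1 / t - sum x {..<n}\<close> is nonnegative. For fixed t > 0 the admissible x form a
  simplex of volume \<open>1 / (fact n * t ^ n)\<close>; its reciprocal is the density used in
  \<open>polar\<close>.\<close>

definition region :: "(nat \<Rightarrow> real) \<Rightarrow> real \<Rightarrow> bool" where
  "region x t \<longleftrightarrow> 0 < t \<and> (\<forall>i<n. 0 < x i) \<and> t * sum x {..<n} \<le> 1"

text \<open>Let t have law \<open>\<gamma>\<close> and let S be independent of t and uniform on the unit simplex in dimension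
  n + 1. Then X = S / t has joint survival function \<open>\<psi> (x\<^sub>0 + \<dots> + x\<^sub>n)\<close>. The measure below is
  the joint law of the first n coordinates of X and of t; the last coordinate of X is 1/t minus
  the sum of the others.\<close>
definition polar :: "((nat \<Rightarrow> real) \<times> real) measure" where
  "polar = density (lam \<Otimes>\<^sub>M \<gamma>)
     (\<lambda>(x, t). if region x t then ennreal (fact n * t ^ n) else 0)"

definition head :: "(nat \<Rightarrow> real) \<Rightarrow> nat \<Rightarrow> real" where
  "head x = (\<lambda>i\<in>{..<n}. \<psi>\<^sub>0 (x i))"

definition tail :: "(nat \<Rightarrow> real) \<Rightarrow> real \<Rightarrow> real" where
  "tail x t = \<psi>\<^sub>0 (1 / t - sum x {..<n})"

lemma measurable_region[measurable]: "Measurable.pred (lam \<Otimes>\<^sub>M \<gamma>) (\<lambda>(x, t). region x t)"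
  unfolding region_def by measurable

lemma measurable_head[measurable]: "head \<in> measurable lam lam"
  unfolding head_def by measurable

lemma measurable_tail[measurable]: "(\<lambda>(x, t). tail x t) \<in> borel_measurable (lam \<Otimes>\<^sub>M \<gamma>)"
  unfolding tail_def by measurable

lemma sets_polar[measurable_cong, simp]: "sets polar = sets (lam \<Otimes>\<^sub>M \<gamma>)"
  by (simp add: polar_def)

lemma space_polar: "space polar = space lam \<times> UNIV"
  by (simp add: polar_def space_pair_measure)

sublocale lam: sigma_finite_measure lam
  by (intro product_sigma_finite.sigma_finite) (auto simp: product_sigma_finite_def lborel.sigma_finite_measure_axioms)

sublocale pair_sigma_finite lam \<gamma> by standard

text \<open>For such t every z in [0, 1/t) lies before the first zero of \<psi>, so that \<phi>
  recovers all simplex coordinates that occur.\<close>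

definition support_ok :: "real \<Rightarrow> bool" where
  "support_ok t \<longleftrightarrow> 0 < t \<and> (\<forall>z. 0 \<le> z \<longrightarrow> t * z < 1 \<longrightarrow> 0 < \<psi> z)"

lemma AE_support_ok: "AE t in \<gamma>. support_ok t"
  using AE_\<gamma>_pos AE_\<gamma>_support by eventually_elim (auto simp: support_ok_def)

text \<open>\<open>region\<close> admits \<open>t * sum x {..<n} = 1\<close>, so the strict bound
  \<open>t * x i < 1\<close> comes from a second positive head coordinate, which exists because
  \<open>n \<ge> 2\<close>. The last coordinate stays below 1/t because the head sum is
  positive.\<close>

lemma regionD:
  assumes "region x t" "support_ok t"
  shows "\<And>i. i < n \<Longrightarrow> 0 < x i \<and> 0 < \<psi> (x i)"
    and "0 \<le> 1 / t - sum x {..<n}" "0 < \<psi> (1 / t - sum x {..<n})"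
proof -
  have t: "0 < t" and x: "\<And>i. i < n \<Longrightarrow> 0 < x i" and s: "t * sum x {..<n} \<le> 1"
    using assms(1) by (auto simp: region_def)
  have ok: "0 < \<psi> z" if "0 \<le> z" "t * z < 1" for z using assms(2) that by (auto simp: support_ok_def)
  show "0 < x i \<and> 0 < \<psi> (x i)" if i: "i < n" for i
  proof -
    obtain j where j: "j < n" "j \<noteq> i"
    proof (cases "i = 0")
      case True then show ?thesis using n that[of 1] by simp
    next
      case False then show ?thesis using n that[of 0] by simp
    qed
    have "x i + x j = sum x {i, j}" using j by simp
    also have "\<dots> \<le> sum x {..<n}" using i j x by (intro sum_mono2) (auto intro: less_imp_le)
    finally have "x i < sum x {..<n}" using x[OF j(1)] by simp
    then have "t * x i < t * sum x {..<n}" using t by simp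
    then show ?thesis using s x[OF i] ok[of "x i"] by simp
  qed
  show nn: "0 \<le> 1 / t - sum x {..<n}" using s t by (simp add: field_simps)
  have "0 < sum x {..<n}" using x n by (intro sum_pos) (auto simp: lessThan_empty_iff)
  then have "t * (1 / t - sum x {..<n}) < 1" using t by (simp add: algebra_simps)
  with nn show "0 < \<psi> (1 / t - sum x {..<n})" by (rule ok)
qed

lemma head_eq:
  assumes "region x t" "support_ok t" "i < n"
  shows "head x i = \<psi> (x i)" "0 < head x i" "head x i \<le> 1" "\<phi> (head x i) = x i"
  using regionD(1)[OF assms] assms(3) phi_psi[of "x i"] psi_le_1[of "x i"] by (auto simp: head_def psi0_eq)

lemma tail_eq:
  assumes "region x t" "support_ok t"
  shows "tail x t = \<psi> (1 / t - sum x {..<n})" "0 < tail x t" "tail x t \<le> 1"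
    "\<phi> (tail x t) = 1 / t - sum x {..<n}"
  using regionD(2,3)[OF assms] phi_psi[of "1 / t - sum x {..<n}"] psi_le_1[of "1 / t - sum x {..<n}"]
  by (auto simp: tail_def psi0_eq)

text \<open>Fubini with x innermost: for fixed t only a volume remains, which suits the distribution
  function.\<close>

lemma emeasure_polar:
  assumes "A \<in> sets (lam \<Otimes>\<^sub>M \<gamma>)"
  shows "emeasure polar A = (\<integral>\<^sup>+t. ennreal (fact n * t ^ n) *
    emeasure lam {x \<in> space lam. region x t \<and> (x, t) \<in> A} \<partial>\<gamma>)"
proof -
  note assms[measurable]
  have "emeasure polar A = (\<integral>\<^sup>+p. (case p of (x, t) \<Rightarrow> (if region x t then ennreal (fact n * t ^ n) else 0)) * indicator A p \<partial>(lam \<Otimes>\<^sub>M \<gamma>))"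
    unfolding polar_def by (rule emeasure_density) measurable
  also have "\<dots> = (\<integral>\<^sup>+t. \<integral>\<^sup>+x. (if region x t then ennreal (fact n * t ^ n) else 0) * indicator A (x, t) \<partial>lam \<partial>\<gamma>)"
    by (subst nn_integral_snd[symmetric]) (auto, measurable)
  also have "\<dots> = (\<integral>\<^sup>+t. \<integral>\<^sup>+x. ennreal (fact n * t ^ n) * indicator {x \<in> space lam. region x t \<and> (x, t) \<in> A} x \<partial>lam \<partial>\<gamma>)"
    by (intro nn_integral_cong) (auto simp: indicator_def)
  also have "\<dots> = (\<integral>\<^sup>+t. ennreal (fact n * t ^ n) * emeasure lam {x \<in> space lam. region x t \<and> (x, t) \<in> A} \<partial>\<gamma>)"
  proof (intro nn_integral_cong nn_integral_cmult_indicator)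
    fix t
    show "{x \<in> space lam. region x t \<and> (x, t) \<in> A} \<in> sets lam"
      unfolding region_def by measurable
  qed
  finally show ?thesis .
qed

text \<open>Fubini with t innermost: for fixed x only a \<gamma>-null set has to be exhibited. This
  is how the type of \<gamma> enters.\<close>

lemma polar_null:
  assumes "A \<in> sets (lam \<Otimes>\<^sub>M \<gamma>)"
    and "\<And>x. x \<in> space lam \<Longrightarrow> AE t in \<gamma>. region x t \<longrightarrow> support_ok t \<longrightarrow> (x, t) \<notin> A"
  shows "emeasure polar A = 0"
proof -
  note assms(1)[measurable]
  have "emeasure polar A = (\<integral>\<^sup>+p. (case p of (x, t) \<Rightarrow> (if region x t then ennreal (fact n * t ^ n) else 0)) * indicator A p \<partial>(lam \<Otimes>\<^sub>M \<gamma>))"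
    unfolding polar_def by (rule emeasure_density) measurable
  also have "\<dots> = (\<integral>\<^sup>+x. \<integral>\<^sup>+t. (if region x t then ennreal (fact n * t ^ n) else 0) * indicator A (x, t) \<partial>\<gamma> \<partial>lam)"
    by (subst \<gamma>.nn_integral_fst[symmetric]) (auto, measurable)
  also have "\<dots> = (\<integral>\<^sup>+x. \<integral>\<^sup>+t. 0 \<partial>\<gamma> \<partial>lam)"
  proof (rule nn_integral_cong, rule nn_integral_cong_AE)
    fix x assume "x \<in> space lam"
    from assms(2)[OF this] AE_support_ok
    show "AE t in \<gamma>. (if region x t then ennreal (fact n * t ^ n) else 0) * indicator A (x, t) = 0"
      by eventually_elim (auto simp: indicator_def)
  qed
  finally show ?thesis by simp
qed

abbreviation lam' :: "(nat \<Rightarrow> real) measure" where "lam' \<equiv> Pi\<^sub>M {..<Suc n} (\<lambda>_. lborel)"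

lemma measurable_head_tail[measurable]: "(\<lambda>(x, t). (head x, tail x t)) \<in> measurable polar (lam \<Otimes>\<^sub>M borel)"
proof -
  have "(\<lambda>p. (head (fst p), (\<lambda>(x, t). tail x t) p)) \<in> measurable (lam \<Otimes>\<^sub>M \<gamma>) (lam \<Otimes>\<^sub>M borel)"
    by measurable
  moreover have "(\<lambda>p. (head (fst p), (\<lambda>(x, t). tail x t) p)) = (\<lambda>(x, t). (head x, tail x t))"
    by (auto simp: fun_eq_iff)
  ultimately show ?thesis by (simp cong: measurable_cong_sets)
qed

lemma measurable_add_last[measurable]: "(\<lambda>(u, y). u(n := y)) \<in> measurable (lam \<Otimes>\<^sub>M borel) lam'"
proof -
  have "(\<lambda>(u, y). u(n := y)) \<in> measurable (lam \<Otimes>\<^sub>M lborel) (Pi\<^sub>M (insert n {..<n}) (\<lambda>_. lborel))"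
    by (rule measurable_add_dim)
  moreover have "sets (lam \<Otimes>\<^sub>M lborel) = sets (lam \<Otimes>\<^sub>M (borel :: real measure))"
    by (intro sets_pair_measure_cong) simp_all
  ultimately show ?thesis by (simp add: lessThan_Suc cong: measurable_cong_sets)
qed

lemma measurable_split_last[measurable]: "(\<lambda>z. (restrict z {..<n}, z n)) \<in> measurable lam' (lam \<Otimes>\<^sub>M borel)"
proof -
  have "(\<lambda>z. z n) \<in> measurable lam' lborel" by (rule measurable_component_singleton) simp
  then have "(\<lambda>z. z n) \<in> measurable lam' borel" by simp
  moreover have "(\<lambda>z. restrict z {..<n}) \<in> measurable lam' lam"
    by (rule measurable_restrict_subset) auto
  ultimately show ?thesis by measurable
qed

definition repr :: "(nat \<Rightarrow> real) measure" where
  "repr = distr polar lam' (\<lambda>(x, t). (head x)(n := tail x t))"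

lemma measurable_repr_map[measurable]: "(\<lambda>(x, t). (head x)(n := tail x t)) \<in> measurable polar lam'"
  using measurable_compose[OF measurable_head_tail measurable_add_last] by (simp add: case_prod_beta)

text \<open>The copula extended to a distribution function on the whole space: levels above 1 count
  as 1, and a nonpositive level gives 0.\<close>

definition box_value :: "(nat \<Rightarrow> real) \<Rightarrow> real" where
  "box_value u = (if \<forall>i<Suc n. 0 < u i then \<psi> (\<Sum>i<Suc n. \<phi> (min (u i) 1)) else 0)"

text \<open>Through \<phi> the box becomes a simplex with corner \<open>a\<close>. Its volume times
  \<open>fact n * t ^ n\<close> is the Williamson integrand at \<open>sum a {..<Suc n}\<close>, and
  integrating over t returns \<psi>.\<close>

lemma emeasure_repr_box: "emeasure repr (PiE {..<Suc n} (\<lambda>i. {..u i})) = ennreal (box_value u)"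
proof -
  define A where "A = (\<lambda>(x, t). (head x)(n := tail x t)) -` PiE {..<Suc n} (\<lambda>i. {..u i}) \<inter> space polar"
  have B: "PiE {..<Suc n} (\<lambda>i. {..u i}) \<in> sets lam'" by (intro sets_PiM_I_finite) auto
  have A_sets: "A \<in> sets (lam \<Otimes>\<^sub>M \<gamma>)"
    unfolding A_def using measurable_sets[OF measurable_repr_map B] by simp
  have mem: "(x, t) \<in> A \<longleftrightarrow> (\<forall>i<n. head x i \<le> u i) \<and> tail x t \<le> u n" if "x \<in> space lam" for x t
    using that unfolding A_def space_polar by (auto simp: PiE_iff head_def extensional_def less_Suc_eq)
  have "emeasure repr (PiE {..<Suc n} (\<lambda>i. {..u i})) = emeasure polar A"
    unfolding repr_def A_def by (rule emeasure_distr[OF measurable_repr_map B])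
  also have "\<dots> = ennreal (box_value u)"
  proof (cases "\<forall>i<Suc n. 0 < u i")
    case False
    \<comment> \<open>All coordinates \<open>head x i\<close> and \<open>tail x t\<close> are
      positive for admissible t, so they never lie below a nonpositive level.\<close>
    have "emeasure polar A = 0"
    proof (rule polar_null[OF A_sets])
      fix x assume x: "x \<in> space lam"
      show "AE t in \<gamma>. region x t \<longrightarrow> support_ok t \<longrightarrow> (x, t) \<notin> A"
        using False head_eq(2)[of x] tail_eq(2)[of x] unfolding mem[OF x]
        by (intro AE_I2 impI) (force simp: less_Suc_eq not_le)
    qed
    then show ?thesis using False unfolding box_value_def by (subst if_not_P) auto
  next
    case True
    define a where "a i = \<phi> (min (u i) 1)" for i
    \<comment> \<open>Merges the strict condition \<open>0 < x i\<close> from \<open>region\<close>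
      with the closed threshold \<open>a i\<close>; the endpoint is lost exactly when
      \<open>a i = 0\<close>.\<close>
    define J where "J i = {0<..} \<inter> {a i..}" for i
    have a: "0 \<le> a i" for i by (simp add: a_def phi_nonneg)
    have "emeasure polar A = (\<integral>\<^sup>+t. ennreal (fact n * t ^ n) *
        emeasure lam {x \<in> space lam. region x t \<and> (x, t) \<in> A} \<partial>\<gamma>)"
      by (rule emeasure_polar[OF A_sets])
    also have "\<dots> = (\<integral>\<^sup>+t. ennreal (max 0 (1 - t * sum a {..<Suc n}) ^ n) \<partial>\<gamma>)"
    proof (intro nn_integral_cong_AE eventually_mono[OF AE_support_ok])
      fix t assume ok: "support_ok t"
      then have t: "0 < t" by (simp add: support_ok_def)
      have "region x t \<and> (x, t) \<in> A \<longleftrightarrow> (\<forall>i\<in>{..<n}. x i \<in> J i) \<and> sum x {..<n} \<le> 1 / t - a n"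
        if x: "x \<in> space lam" for x
      proof -
        have "region x t \<longleftrightarrow> (\<forall>i<n. 0 < x i) \<and> sum x {..<n} \<le> 1 / t"
          using t by (auto simp: region_def field_simps)
        moreover have "(x, t) \<in> A \<longleftrightarrow> (\<forall>i<n. a i \<le> x i) \<and> sum x {..<n} \<le> 1 / t - a n" if r: "region x t"
        proof -
          have "head x i \<le> u i \<longleftrightarrow> a i \<le> x i" if "i < n" for i
          proof -
            have "head x i \<le> u i \<longleftrightarrow> \<psi> (x i) \<le> min (u i) 1"
              using head_eq[OF r ok that] by auto
            then show ?thesis
              using psi_le_iff[of "min (u i) 1" "x i"] True that regionD(1)[OF r ok that] by (simp add: a_def)
          qed
          moreover have "tail x t \<le> u n \<longleftrightarrow> a n \<le> 1 / t - sum x {..<n}"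
          proof -
            have "tail x t \<le> u n \<longleftrightarrow> \<psi> (1 / t - sum x {..<n}) \<le> min (u n) 1"
              using tail_eq[OF r ok] by auto
            then show ?thesis
              using psi_le_iff[of "min (u n) 1" "1 / t - sum x {..<n}"] True regionD(2)[OF r ok]
              by (simp add: a_def)
          qed
          ultimately show ?thesis unfolding mem[OF x] by auto
        qed
        ultimately show ?thesis using a[of n] by (auto simp: J_def)
      qed
      then have "{x \<in> space lam. region x t \<and> (x, t) \<in> A}
          = {x \<in> space lam. (\<forall>i\<in>{..<n}. x i \<in> J i) \<and> sum x {..<n} \<le> 1 / t - a n}"
        by blast
      also have "emeasure lam \<dots> = ennreal (if sum a {..<n} \<le> 1 / t - a n
          then (1 / t - a n - sum a {..<n}) ^ n / fact n else 0)"
        using emeasure_shifted_simplex[of "{..<n}" J a "1 / t - a n"] a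
        by (force simp: J_def intro: le_less_trans)
      \<comment> \<open>The case distinction becomes a positive part because
        \<open>0 ^ n = 0\<close> for positive n.\<close>
      also have "\<dots> = ennreal (max 0 (1 / t - sum a {..<Suc n}) ^ n / fact n)"
        using n by (auto simp: max_def algebra_simps)
      also have "ennreal (fact n * t ^ n) * \<dots> = ennreal ((t * max 0 (1 / t - sum a {..<Suc n})) ^ n)"
        using t by (simp add: ennreal_mult[symmetric] power_mult_distrib)
      also have "t * max 0 (1 / t - sum a {..<Suc n}) = max 0 (1 - t * sum a {..<Suc n})"
        using t by (simp add: max_mult_distrib_left right_diff_distrib del: sum.lessThan_Suc)
      finally show "ennreal (fact n * t ^ n) * emeasure lam {x \<in> space lam. region x t \<and> (x, t) \<in> A}
          = ennreal (max 0 (1 - t * sum a {..<Suc n}) ^ n)" .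
    qed
    also have "\<dots> = ennreal (\<psi> (sum a {..<Suc n}))"
    proof -
      have "0 \<le> sum a {..<Suc n}" using a by (rule sum_nonneg)
      then show ?thesis
        by (subst nn_integral_eq_integral[OF integrable_kernel]) (simp_all only: psi_eq, simp)
    qed
    finally show ?thesis using True by (simp add: box_value_def a_def)
  qed
  finally show ?thesis .
qed

end

section \<open>Identification of the copula measure with the stochastic representation\<close>

locale archimedean_copula = williamson_generator +
  fixes \<mu> :: "(nat \<Rightarrow> real) measure"
  assumes copula: "copula_measure_of (Suc n) (arch_copula (Suc n) \<psi>) \<mu>"
begin

sublocale \<mu>: prob_space \<mu>
  using copula by (simp add: copula_measure_of_def)

lemma sets_\<mu>[measurable_cong, simp]: "sets \<mu> = sets lam'"
  using copula by (simp add: copula_measure_of_def)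

lemma space_\<mu>: "space \<mu> = space lam'"
  by (rule sets_eq_imp_space_eq) simp

lemma measure_box:
  assumes "\<And>i. i < Suc n \<Longrightarrow> 0 \<le> u i \<and> u i \<le> 1"
  shows "measure \<mu> (PiE {..<Suc n} (\<lambda>i. {0..u i})) = arch_copula (Suc n) \<psi> u"
proof -
  let ?u = "restrict u {..<Suc n}"
  have "?u \<in> unit_cube (Suc n)" using assms by (auto simp: unit_cube_def PiE_iff)
  then have "measure \<mu> (PiE {..<Suc n} (\<lambda>i. {0..?u i})) = arch_copula (Suc n) \<psi> ?u"
    using copula unfolding copula_measure_of_def by blast
  moreover have "PiE {..<Suc n} (\<lambda>i. {0..?u i}) = PiE {..<Suc n} (\<lambda>i. {0..u i})"
    by (rule PiE_cong) auto
  moreover have "arch_copula (Suc n) \<psi> ?u = arch_copula (Suc n) \<psi> u"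
    unfolding arch_copula_def by (intro arg_cong[of _ _ "gen_ext \<psi>"] sum.cong) auto
  ultimately show ?thesis by simp
qed

lemma sets_cube[measurable]: "unit_cube (Suc n) \<in> sets lam'"
  unfolding unit_cube_def by (intro sets_PiM_I_finite) auto

lemma phi_1: "\<phi> 1 = 0"
  using phi_psi[of 0] by simp

lemma AE_cube: "AE z in \<mu>. z \<in> unit_cube (Suc n)"
proof -
  have "measure \<mu> (unit_cube (Suc n)) = 1"
    using measure_box[of "\<lambda>_. 1"] arch_copula_pos[of "Suc n" "\<lambda>_. 1"] phi_1 by (simp add: unit_cube_def)
  then show ?thesis by (subst \<mu>.prob_eq_1[symmetric]) auto
qed

lemma emeasure_\<mu>_box: "emeasure \<mu> (PiE {..<Suc n} (\<lambda>i. {..u i})) = ennreal (box_value u)"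
proof (cases "\<forall>i<Suc n. 0 < u i")
  case True
  have "emeasure \<mu> (PiE {..<Suc n} (\<lambda>i. {..u i})) = emeasure \<mu> (PiE {..<Suc n} (\<lambda>i. {0..min (u i) 1}))"
  proof (rule emeasure_eq_AE)
    show "AE z in \<mu>. z \<in> PiE {..<Suc n} (\<lambda>i. {..u i}) \<longleftrightarrow> z \<in> PiE {..<Suc n} (\<lambda>i. {0..min (u i) 1})"
      using AE_cube by eventually_elim (auto simp: unit_cube_def PiE_iff)
  qed (auto intro!: sets_PiM_I_finite)
  also have "\<dots> = ennreal (arch_copula (Suc n) \<psi> (\<lambda>i. min (u i) 1))"
    using True by (subst \<mu>.emeasure_eq_measure, subst measure_box) (auto simp: less_imp_le)
  also have "\<dots> = ennreal (box_value u)"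
    using True by (subst arch_copula_pos) (auto simp: box_value_def)
  finally show ?thesis .
next
  case False
  then obtain j where j: "j < Suc n" "u j \<le> 0" by (auto simp: not_less)
  \<comment> \<open>Almost surely the orthant lies in the face of the cube where coordinate j is 0,
    and the copula vanishes at the corner \<open>?w\<close> of that face.\<close>
  let ?w = "\<lambda>i. if i = j then 0 else 1 :: real"
  have "emeasure \<mu> (PiE {..<Suc n} (\<lambda>i. {..u i})) \<le> emeasure \<mu> (PiE {..<Suc n} (\<lambda>i. {0..?w i}))"
  proof (rule emeasure_mono_AE)
    show "AE z in \<mu>. z \<in> PiE {..<Suc n} (\<lambda>i. {..u i}) \<longrightarrow> z \<in> PiE {..<Suc n} (\<lambda>i. {0..?w i})"
      using AE_cube by eventually_elim (use j in \<open>force simp: unit_cube_def PiE_iff\<close>)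
  qed (auto intro!: sets_PiM_I_finite)
  also have "\<dots> = 0"
    using j arch_copula_0[of j "Suc n" ?w] by (subst \<mu>.emeasure_eq_measure, subst measure_box) auto
  finally show ?thesis using False unfolding box_value_def by (subst if_not_P) auto
qed

lemma \<mu>_eq_repr: "\<mu> = repr"
  using \<mu>.finite_measure_axioms
  by (intro measure_eqI_PiM_atMost[of "{..<Suc n}"]) (simp_all add: emeasure_\<mu>_box emeasure_repr_box, simp add: repr_def)

text \<open>Splitting off the last coordinate gives a measure on a binary product, where sections
  and kernels live.\<close>

definition pair\<mu> :: "((nat \<Rightarrow> real) \<times> real) measure" where
  "pair\<mu> = distr \<mu> (lam \<Otimes>\<^sub>M borel) (\<lambda>z. (restrict z {..<n}, z n))"

lemma sets_pair\<mu>[measurable_cong, simp]: "sets pair\<mu> = sets (lam \<Otimes>\<^sub>M borel)"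
  by (simp add: pair\<mu>_def)

lemma space_pair\<mu>: "space pair\<mu> = space lam \<times> UNIV"
  by (simp add: pair\<mu>_def space_pair_measure)

lemma pair\<mu>_eq: "pair\<mu> = distr polar (lam \<Otimes>\<^sub>M borel) (\<lambda>(x, t). (head x, tail x t))"
proof -
  have "pair\<mu> = distr polar (lam \<Otimes>\<^sub>M borel) ((\<lambda>z. (restrict z {..<n}, z n)) \<circ> (\<lambda>(x, t). (head x)(n := tail x t)))"
    by (subst pair\<mu>_def, subst \<mu>_eq_repr, subst repr_def)
      (rule distr_distr[OF measurable_split_last measurable_repr_map])
  also have "(\<lambda>z. (restrict z {..<n}, z n)) \<circ> (\<lambda>(x, t). (head x)(n := tail x t)) = (\<lambda>(x, t). (head x, tail x t))"
    by (auto simp: fun_eq_iff head_def)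
  finally show ?thesis .
qed

section \<open>Null sets of the copula described by their sections\<close>

lemma pair\<mu>_null:
  assumes G: "G \<in> sets (lam \<Otimes>\<^sub>M borel)"
    and "\<And>x. x \<in> space lam \<Longrightarrow> AE t in \<gamma>. region x t \<longrightarrow> support_ok t \<longrightarrow> (head x, tail x t) \<notin> G"
  shows "emeasure pair\<mu> G = 0"
proof -
  have "emeasure pair\<mu> G = emeasure polar ((\<lambda>(x, t). (head x, tail x t)) -` G \<inter> space polar)"
    unfolding pair\<mu>_eq by (rule emeasure_distr[OF measurable_head_tail G])
  also have "\<dots> = 0"
  proof (rule polar_null)
    show "(\<lambda>(x, t). (head x, tail x t)) -` G \<inter> space polar \<in> sets (lam \<Otimes>\<^sub>M \<gamma>)"
      using measurable_sets[OF measurable_head_tail G] by simp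
    fix x assume "x \<in> space lam"
    from assms(2)[OF this]
    show "AE t in \<gamma>. region x t \<longrightarrow> support_ok t \<longrightarrow> (x, t) \<notin> (\<lambda>(x, t). (head x, tail x t)) -` G \<inter> space polar"
      by eventually_elim auto
  qed
  finally show ?thesis .
qed

text \<open>With x fixed, t is recovered from the last coordinate y as the inverse of
  \<open>sum x {..<n} + \<phi> y\<close>. The value y = 1 yields the single point
  \<open>inverse (sum x {..<n})\<close>, so that \<phi> acts only on the open interval covered by
  \<open>negligible_phi_image\<close>.\<close>

lemma preimage_section:
  assumes "region x t" "support_ok t" "(head x, tail x t) \<in> G"
  shows "t \<in> {inverse (sum x {..<n})} \<union>
    inverse ` ((+) (sum x {..<n}) ` \<phi> ` (Pair (head x) -` G \<inter> {0<..<1}) - {0})"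
proof (cases "tail x t = 1")
  case True
  then have "1 / t = sum x {..<n}" using tail_eq(4)[OF assms(1,2)] phi_1 by simp
  then show ?thesis by (metis Un_iff inverse_eq_divide inverse_inverse_eq singletonI)
next
  case False
  have t: "0 < t" using assms(1) by (simp add: region_def)
  let ?v = "sum x {..<n} + \<phi> (tail x t)"
  have v: "?v = inverse t" using tail_eq(4)[OF assms(1,2)] by (simp add: inverse_eq_divide)
  have "tail x t \<in> Pair (head x) -` G \<inter> {0<..<1}" using tail_eq[OF assms(1,2)] False assms(3) by auto
  then have "?v \<in> (+) (sum x {..<n}) ` \<phi> ` (Pair (head x) -` G \<inter> {0<..<1}) - {0}"
    using v t by (intro DiffI imageI) auto
  moreover have "t = inverse ?v" using v by simp
  ultimately show ?thesis by blast
qed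

lemma pair\<mu>_null_if_countable_sections:
  assumes "G \<in> sets (lam \<Otimes>\<^sub>M borel)" "\<And>u. countable (Pair u -` G)" "\<And>t. emeasure \<gamma> {t} = 0"
  shows "emeasure pair\<mu> G = 0"
proof (rule pair\<mu>_null[OF assms(1)])
  fix x
  let ?N = "{inverse (sum x {..<n})} \<union>
    inverse ` ((+) (sum x {..<n}) ` \<phi> ` (Pair (head x) -` G \<inter> {0<..<1}) - {0})"
  have "countable ?N" using assms(2)[of "head x"] by auto
  then have "(\<Union>t\<in>?N. {t}) \<in> null_sets \<gamma>"
    by (rule null_sets_UN') (use assms(3) in \<open>auto simp: null_sets_def\<close>)
  then have "?N \<in> null_sets \<gamma>" by (simp only: UN_singleton)
  then have "AE t in \<gamma>. t \<notin> ?N" by (rule AE_not_in)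
  then show "AE t in \<gamma>. region x t \<longrightarrow> support_ok t \<longrightarrow> (head x, tail x t) \<notin> G"
    by (rule eventually_mono) (use preimage_section[of x _ G] in meson)
qed

lemma pair\<mu>_null_if_negligible_sections:
  assumes "G \<in> sets (lam \<Otimes>\<^sub>M borel)" "\<And>u. negligible (Pair u -` G)" "absolutely_continuous lborel \<gamma>"
  shows "emeasure pair\<mu> G = 0"
proof (rule pair\<mu>_null[OF assms(1)])
  fix x
  let ?N = "{inverse (sum x {..<n})} \<union>
    inverse ` ((+) (sum x {..<n}) ` \<phi> ` (Pair (head x) -` G \<inter> {0<..<1}) - {0})"
  have "negligible (Pair (head x) -` G \<inter> {0<..<1})" using assms(2) by (rule negligible_Int[OF disjI1])
  then have "negligible ((+) (sum x {..<n}) ` \<phi> ` (Pair (head x) -` G \<inter> {0<..<1}))"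
    by (intro negligible_translation negligible_phi_image) auto
  then have "negligible ?N"
    by (intro negligible_Un negligible_sing negligible_inverse_image negligible_diff) auto
  \<comment> \<open>The image is not known to be Borel; absolute continuity of \<gamma> is applied
    to a Borel null set covering it.\<close>
  then have "?N \<in> null_sets lebesgue" by (simp add: negligible_iff_null_sets)
  then obtain N' where "N' \<in> null_sets lborel" "?N \<subseteq> N'"
    by (auto simp: null_sets_completion_iff2)
  then have "AE t in lborel. t \<notin> N'" by (intro AE_not_in)
  then have "AE t in \<gamma>. t \<notin> N'" using assms(3) by (intro absolutely_continuous_AE[of \<gamma> lborel]) auto
  then show "AE t in \<gamma>. region x t \<longrightarrow> support_ok t \<longrightarrow> (head x, tail x t) \<notin> G"
    by eventually_elim (use preimage_section[of x _ G] \<open>?N \<subseteq> N'\<close> in blast)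
qed

text \<open>G collects the points at which the sum of \<open>\<phi>\<close> over all coordinates, which recovers 1/t, is the
  inverse of an element of Z.\<close>
lemma pair\<mu>_concentrated:
  assumes Z: "Z \<in> sets borel" "emeasure \<gamma> (UNIV - Z) = 0"
  obtains G where "G \<in> sets (lam \<Otimes>\<^sub>M borel)" "emeasure pair\<mu> (space pair\<mu> - G) = 0"
    "\<And>u. \<exists>s. Pair u -` G \<subseteq> {1} \<union> \<psi> ` (((+) (- s) ` inverse ` (Z - {0})) \<inter> {0<..})"
proof
  note Z(1)[measurable]
  define P where "P u y \<longleftrightarrow> (\<forall>i<n. 0 < u i \<and> u i \<le> 1) \<and> 0 < y \<and> y \<le> 1 \<and>
    inverse ((\<Sum>i<n. \<phi> (u i)) + \<phi> y) \<in> Z" for u :: "nat \<Rightarrow> real" and y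
  define G where "G = {p \<in> space (lam \<Otimes>\<^sub>M borel). P (fst p) (snd p)}"
  show G: "G \<in> sets (lam \<Otimes>\<^sub>M borel)" unfolding G_def P_def by measurable
  show "emeasure pair\<mu> (space pair\<mu> - G) = 0"
  proof (rule pair\<mu>_null)
    show "space pair\<mu> - G \<in> sets (lam \<Otimes>\<^sub>M borel)" using G by (metis sets.compl_sets sets_pair\<mu>)
    fix x assume x: "x \<in> space lam"
    have "UNIV - Z \<in> null_sets \<gamma>" using Z by (auto simp: null_sets_def)
    then have "AE t in \<gamma>. t \<in> Z" using AE_not_in by force
    then show "AE t in \<gamma>. region x t \<longrightarrow> support_ok t \<longrightarrow> (head x, tail x t) \<notin> space pair\<mu> - G"
    proof (eventually_elim, intro impI)
      fix t assume "t \<in> Z" and r: "region x t" and ok: "support_ok t"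
      have "(\<Sum>i<n. \<phi> (head x i)) = sum x {..<n}" using head_eq(4)[OF r ok] by (intro sum.cong) auto
      then have "inverse ((\<Sum>i<n. \<phi> (head x i)) + \<phi> (tail x t)) = t"
        using tail_eq(4)[OF r ok] by (simp add: inverse_eq_divide)
      then have "P (head x) (tail x t)"
        unfolding P_def using head_eq[OF r ok] tail_eq[OF r ok] \<open>t \<in> Z\<close> by auto
      moreover have "head x \<in> space lam" by (auto simp: head_def space_PiM)
      ultimately show "(head x, tail x t) \<notin> space pair\<mu> - G" by (simp add: G_def space_pair_measure)
    qed
  qed
  fix u
  define s where "s = (\<Sum>i<n. \<phi> (u i))"
  have s: "0 \<le> s" unfolding s_def by (intro sum_nonneg phi_nonneg)
  have "y \<in> {1} \<union> \<psi> ` (((+) (- s) ` inverse ` (Z - {0})) \<inter> {0<..})" if "y \<in> Pair u -` G" for y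
  \<comment> \<open>y = 1 corresponds to \<phi> y = 0, where \<psi> may have unbounded slope; all
    other y come from positive arguments of \<psi>.\<close>
  proof (cases "y = 1")
    case False
    have y: "0 < y" "y \<le> 1" "inverse (s + \<phi> y) \<in> Z" using that by (auto simp: G_def P_def s_def)
    have "\<phi> y \<noteq> 0" using phi(2)[OF y(1,2)] False by (metis psi_0)
    then have pos: "0 < \<phi> y" using phi_nonneg[of y] by simp
    then have "inverse (s + \<phi> y) \<in> Z - {0}" using y s by simp
    then have "- s + inverse (inverse (s + \<phi> y)) \<in> (+) (- s) ` inverse ` (Z - {0})" by blast
    then have "\<phi> y \<in> ((+) (- s) ` inverse ` (Z - {0})) \<inter> {0<..}" using pos by simp
    then show ?thesis using phi(2)[OF y(1,2)] by (metis UnI2 imageI)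
  qed simp
  then show "\<exists>s. Pair u -` G \<subseteq> {1} \<union> \<psi> ` (((+) (- s) ` inverse ` (Z - {0})) \<inter> {0<..})" by blast
qed

end

subsection \<open>Disintegration\<close>

locale copula_kernel = archimedean_copula +
  fixes c :: "(nat \<Rightarrow> real) \<Rightarrow> real" and K :: "(nat \<Rightarrow> real) \<Rightarrow> real measure"
  assumes c[measurable]: "c \<in> borel_measurable lam"
    and marginal: "distr \<mu> lam (\<lambda>z. restrict z {..<n}) = density lam (\<lambda>x. ennreal (c x))"
    and kernel: "markov_kernel_of (Suc n) \<mu> K"
begin

definition \<nu> :: "(nat \<Rightarrow> real) measure" where "\<nu> = density lam (\<lambda>x. ennreal (c x))"

lemma sets_\<nu>[measurable_cong, simp]: "sets \<nu> = sets lam" by (simp add: \<nu>_def)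

lemma space_\<nu>[simp]: "space \<nu> = space lam" by (simp add: \<nu>_def)

lemma \<nu>_eq: "\<nu> = distr \<mu> lam (\<lambda>z. restrict z {..<n})" by (simp add: \<nu>_def marginal)

lemma measurable_init[measurable]: "(\<lambda>z. restrict z {..<n}) \<in> measurable \<mu> lam"
proof -
  have "(\<lambda>z. restrict z {..<n}) \<in> measurable lam' lam" by (rule measurable_restrict_subset) auto
  then show ?thesis by (simp cong: measurable_cong_sets)
qed

lemma measurable_split_\<mu>: "(\<lambda>z. (restrict z {..<n}, z n)) \<in> measurable \<mu> (lam \<Otimes>\<^sub>M borel)"
  using measurable_split_last by (simp cong: measurable_cong_sets)

sublocale \<nu>: prob_space \<nu>
  unfolding \<nu>_eq by (rule \<mu>.prob_space_distr) measurable

lemma K_prob[measurable]: "K \<in> measurable lam (prob_algebra borel)"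
  using kernel by (simp add: markov_kernel_of_def)

lemma K_subprob: "K \<in> measurable lam (subprob_algebra borel)"
  by (rule measurable_prob_algebraD[OF K_prob])

lemma K_space: "x \<in> space lam \<Longrightarrow> prob_space (K x) \<and> sets (K x) = sets borel"
  by (drule measurable_space[OF K_prob]) (simp add: space_prob_algebra)

lemma subprob_kernel_space:
  "L \<in> measurable lam (subprob_algebra borel) \<Longrightarrow> x \<in> space lam \<Longrightarrow> subprob_space (L x) \<and> sets (L x) = sets borel"
  by (drule (1) measurable_space) (simp add: space_subprob_algebra)

lemma section_sets:
  assumes "G \<in> sets (lam \<Otimes>\<^sub>M borel)" shows "Pair x -` G \<in> sets borel"
  using sets_Pair1[OF assms, of x] by simp

text \<open>Pushing \<open>L x\<close> along \<open>Pair x\<close> makes it a kernel into the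
  product space. Measurability of section masses and the joint law as a \<open>bind\<close> both
  follow from this form.\<close>

lemma measurable_graph_kernel:
  assumes "L \<in> measurable lam (subprob_algebra borel)"
  shows "(\<lambda>x. distr (L x) (lam \<Otimes>\<^sub>M borel) (Pair x)) \<in> measurable lam (subprob_algebra (lam \<Otimes>\<^sub>M borel))"
  by (rule measurable_distr2[OF _ assms]) simp

lemma emeasure_graph_kernel:
  assumes "L \<in> measurable lam (subprob_algebra borel)" "x \<in> space lam" "G \<in> sets (lam \<Otimes>\<^sub>M borel)"
  shows "emeasure (distr (L x) (lam \<Otimes>\<^sub>M borel) (Pair x)) G = emeasure (L x) (Pair x -` G)"
proof -
  have L: "sets (L x) = sets borel" using subprob_kernel_space[OF assms(1,2)] by simp
  then have "Pair x \<in> measurable (L x) (lam \<Otimes>\<^sub>M borel)"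
    using assms(2) by (simp cong: measurable_cong_sets)
  then have "emeasure (distr (L x) (lam \<Otimes>\<^sub>M borel) (Pair x)) G = emeasure (L x) (Pair x -` G \<inter> space (L x))"
    using assms(3) by (rule emeasure_distr)
  then show ?thesis using sets_eq_imp_space_eq[OF L] by simp
qed

lemma measurable_kernel_section:
  assumes "L \<in> measurable lam (subprob_algebra borel)" "G \<in> sets (lam \<Otimes>\<^sub>M borel)"
  shows "(\<lambda>x. emeasure (L x) (Pair x -` G)) \<in> borel_measurable lam"
proof -
  have "(\<lambda>x. emeasure (distr (L x) (lam \<Otimes>\<^sub>M borel) (Pair x)) G) \<in> borel_measurable lam"
    by (rule measurable_compose[OF measurable_graph_kernel[OF assms(1)] measurable_emeasure_subprob_algebra[OF assms(2)]])
  then show ?thesis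
    using emeasure_graph_kernel[OF assms(1) _ assms(2)] by (simp cong: measurable_cong)
qed

lemma pair\<mu>_rectangle:
  assumes A: "A \<in> sets lam" and B: "B \<in> sets borel"
  shows "emeasure pair\<mu> (A \<times> B) = (\<integral>\<^sup>+x\<in>A. emeasure (K x) B \<partial>\<nu>)"
proof -
  have "emeasure pair\<mu> (A \<times> B) = emeasure \<mu> ((\<lambda>z. (restrict z {..<n}, z n)) -` (A \<times> B) \<inter> space \<mu>)"
    unfolding pair\<mu>_def
    using A B by (intro emeasure_distr[OF measurable_split_\<mu>]) simp
  also have "(\<lambda>z. (restrict z {..<n}, z n)) -` (A \<times> B) \<inter> space \<mu> = {z \<in> space \<mu>. restrict z {..<n} \<in> A \<and> z n \<in> B}"
    by auto
  also have "emeasure \<mu> \<dots> = (\<integral>\<^sup>+x\<in>A. emeasure (K x) B \<partial>\<nu>)"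
    using kernel A B unfolding markov_kernel_of_def \<nu>_eq by simp
  finally show ?thesis .
qed

text \<open>The kernel property speaks of rectangles only; these are stable under intersection and
  generate, so it extends to every measurable set of the product.\<close>

lemma disintegration:
  assumes G: "G \<in> sets (lam \<Otimes>\<^sub>M borel)"
  shows "emeasure pair\<mu> G = (\<integral>\<^sup>+x. emeasure (K x) (Pair x -` G) \<partial>\<nu>)"
proof -
  let ?\<kappa> = "\<lambda>x. distr (K x) (lam \<Otimes>\<^sub>M borel) (Pair x)"
  have \<kappa>: "?\<kappa> \<in> measurable \<nu> (subprob_algebra (lam \<Otimes>\<^sub>M borel))"
    using measurable_graph_kernel[OF K_subprob] by (simp cong: measurable_cong_sets)
  have bind: "emeasure (\<nu> \<bind> ?\<kappa>) G = (\<integral>\<^sup>+x. emeasure (K x) (Pair x -` G) \<partial>\<nu>)" if G: "G \<in> sets (lam \<Otimes>\<^sub>M borel)" for G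
  proof -
    have "emeasure (\<nu> \<bind> ?\<kappa>) G = (\<integral>\<^sup>+x. emeasure (?\<kappa> x) G \<partial>\<nu>)"
      by (rule emeasure_bind[OF \<nu>.not_empty \<kappa> G])
    also have "\<dots> = (\<integral>\<^sup>+x. emeasure (K x) (Pair x -` G) \<partial>\<nu>)"
      using emeasure_graph_kernel[OF K_subprob _ G] by (intro nn_integral_cong) simp
    finally show ?thesis .
  qed
  have "pair\<mu> = \<nu> \<bind> ?\<kappa>"
  proof (rule measure_eqI_generator_eq[OF Int_stable_pair_measure_generator])
    let ?E = "{a \<times> b | a b. a \<in> sets lam \<and> b \<in> sets (borel :: real measure)}"
    let ?\<Omega> = "space lam \<times> space (borel :: real measure)"
    show "?E \<subseteq> Pow ?\<Omega>" by (rule pair_measure_closed)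
    show "sets pair\<mu> = sigma_sets ?\<Omega> ?E" by (simp add: sets_pair_measure)
    have "sets (\<nu> \<bind> ?\<kappa>) = sets (lam \<Otimes>\<^sub>M borel)"
      by (rule sets_bind) (auto simp: \<nu>.not_empty)
    then show "sets (\<nu> \<bind> ?\<kappa>) = sigma_sets ?\<Omega> ?E" by (simp add: sets_pair_measure)
    show "range (\<lambda>_ :: nat. ?\<Omega>) \<subseteq> ?E" by blast
    show "emeasure pair\<mu> ?\<Omega> \<noteq> \<infinity>"
      unfolding pair\<mu>_def by (subst emeasure_distr[OF measurable_split_\<mu>]) auto
    fix X assume "X \<in> ?E"
    then obtain A B where X: "X = A \<times> B" and A: "A \<in> sets lam" and B: "B \<in> sets borel" by blast
    have "emeasure (\<nu> \<bind> ?\<kappa>) X = (\<integral>\<^sup>+x. emeasure (K x) (Pair x -` (A \<times> B)) \<partial>\<nu>)"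
      unfolding X using A B by (intro bind) simp
    also have "\<dots> = (\<integral>\<^sup>+x\<in>A. emeasure (K x) B \<partial>\<nu>)"
      by (intro nn_integral_cong) (auto simp: indicator_def vimage_def)
    finally show "emeasure pair\<mu> X = emeasure (\<nu> \<bind> ?\<kappa>) X"
      using pair\<mu>_rectangle[OF A B] X by simp
  qed auto
  with bind[OF G] show ?thesis by simp
qed

lemma AE_section_null:
  assumes "G \<in> sets (lam \<Otimes>\<^sub>M borel)" "emeasure pair\<mu> G = 0"
  shows "AE x in \<nu>. emeasure (K x) (Pair x -` G) = 0"
proof -
  have "(\<lambda>x. emeasure (K x) (Pair x -` G)) \<in> borel_measurable \<nu>"
    using measurable_kernel_section[OF K_subprob assms(1)] by (simp cong: measurable_cong_sets)
  from nn_integral_0_iff_AE[OF this] show ?thesis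
    using disintegration[OF assms(1)] assms(2) by simp
qed

text \<open>Where the other two parts vanish, \<open>L x\<close> inherits the full mass of
  \<open>K x\<close>, which sits on [0,1] for almost every x. Integrating 1 against the marginal
  density gives 1.\<close>

lemma mu_part_cube:
  assumes L: "L \<in> measurable lam (subprob_algebra borel)"
    and K: "\<And>x B. B \<in> sets borel \<Longrightarrow> emeasure (K x) B = emeasure (L x) B + emeasure (L1 x) B + emeasure (L2 x) B"
    and null: "AE x in \<nu>. emeasure (L1 x) UNIV = 0" "AE x in \<nu>. emeasure (L2 x) UNIV = 0"
    and L12: "L1 \<in> measurable lam (subprob_algebra borel)" "L2 \<in> measurable lam (subprob_algebra borel)"
  shows "mu_part (Suc n) L c (unit_cube (Suc n)) = 1"
proof -
  have [measurable]: "unit_cube n \<in> sets lam"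
    unfolding unit_cube_def by (intro sets_PiM_I_finite) auto
  have G: "space lam \<times> (UNIV - {0..1}) \<in> sets (lam \<Otimes>\<^sub>M (borel :: real measure))" by auto
  have "emeasure pair\<mu> (space lam \<times> (UNIV - {0..1})) = emeasure \<mu> ((\<lambda>z. (restrict z {..<n}, z n)) -` (space lam \<times> (UNIV - {0..1})) \<inter> space \<mu>)"
    unfolding pair\<mu>_def by (rule emeasure_distr[OF measurable_split_\<mu> G])
  also have "\<dots> = 0"
  proof -
    have "AE z in \<mu>. z \<notin> (\<lambda>z. (restrict z {..<n}, z n)) -` (space lam \<times> (UNIV - {0..1})) \<inter> space \<mu>"
      using AE_cube by eventually_elim (simp add: unit_cube_def PiE_iff)
    then show ?thesis
      using measurable_sets[OF measurable_split_\<mu> G] by (subst (asm) AE_iff_null_sets[symmetric]) auto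
  qed
  finally have "emeasure pair\<mu> (space lam \<times> (UNIV - {0..1})) = 0" .
  from AE_section_null[OF G this] AE_space
  have K01: "AE x in \<nu>. emeasure (K x) (UNIV - {0..1}) = 0"
    by eventually_elim (simp add: vimage_def set_diff_eq)
  have cube: "AE x in \<nu>. x \<in> unit_cube n"
    unfolding \<nu>_eq
  proof (subst AE_distr_iff)
    show "AE z in \<mu>. restrict z {..<n} \<in> unit_cube n"
      using AE_cube by eventually_elim (auto simp: unit_cube_def PiE_iff)
  qed auto
  have one: "AE x in \<nu>. emeasure (L x) {0..1} * indicator (unit_cube n) x = 1"
    using K01 cube null AE_space
  proof eventually_elim
    case (elim x)
    then have x: "x \<in> space lam" by simp
    interpret prob_space "K x" using K_space[OF x] by simp
    have sp: "space (K x) = UNIV" using K_space[OF x] sets_eq_imp_space_eq[of "K x" borel] by simp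
    have "emeasure (K x) {0..1} = 1"
    proof (rule emeasure_eq_1_AE)
      have "UNIV - {0..1} \<in> null_sets (K x)" using elim(1) K_space[OF x] by (auto simp: null_sets_def)
      from AE_not_in[OF this] show "AE y in K x. y \<in> {0..1}" by simp
    qed (use K_space[OF x] in simp)
    moreover have "emeasure (L1 x) {0..1} = 0" "emeasure (L2 x) {0..1} = 0"
      using elim(3,4) subprob_kernel_space[OF L12(1) x] subprob_kernel_space[OF L12(2) x]
      by (auto intro: emeasure_eq_0[of UNIV])
    ultimately show ?case using K[of "{0..1}" x] elim(2) by simp
  qed
  have "mu_part (Suc n) L c (unit_cube (Suc n))
      = (\<integral>\<^sup>+x. ennreal (c x) * (emeasure (L x) {0..1} * indicator (unit_cube n) x) \<partial>lam)"
    unfolding mu_part_def diff_Suc_1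
  proof (rule nn_integral_cong)
    fix x
    have "{y. x(n := y) \<in> unit_cube (Suc n)} = {0..1}" if "x \<in> unit_cube n"
      using that by (auto simp: unit_cube_def PiE_iff extensional_def less_Suc_eq)
    then show "emeasure (L x) {y. x(n := y) \<in> unit_cube (Suc n)} * ennreal (c x) * indicator (unit_cube n) x
        = ennreal (c x) * (emeasure (L x) {0..1} * indicator (unit_cube n) x)"
      by (simp add: indicator_def mult.commute)
  qed
  also have "\<dots> = (\<integral>\<^sup>+x. emeasure (L x) {0..1} * indicator (unit_cube n) x \<partial>\<nu>)"
    unfolding \<nu>_def using measurable_compose[OF L measurable_emeasure_subprob_algebra[of "{0..1}"]]
    by (subst nn_integral_density) auto
  also have "\<dots> = (\<integral>\<^sup>+x. 1 \<partial>\<nu>)" by (rule nn_integral_cong_AE[OF one])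
  finally show ?thesis using \<nu>.emeasure_space_1 by simp
qed

section \<open>Criteria for a part of the kernel to vanish\<close>

lemma AE_concentrated:
  assumes G: "G \<in> sets (lam \<Otimes>\<^sub>M borel)" "emeasure pair\<mu> (space pair\<mu> - G) = 0"
  shows "AE x in \<nu>. emeasure (K x) (UNIV - Pair x -` G) = 0"
proof -
  have "space pair\<mu> - G \<in> sets (lam \<Otimes>\<^sub>M borel)" using G by (metis sets.compl_sets sets_pair\<mu>)
  from AE_section_null[OF this G(2)] AE_space show ?thesis
    by eventually_elim (simp add: space_pair\<mu> vimage_def set_diff_eq)
qed

text \<open>Being dominated by \<open>K x\<close>, almost every \<open>L x\<close> lives on the
  section of G, which it is also assumed to ignore. Sections are tested only when \<open>L x\<close>
  is a Borel measure, because this is known only for x in \<open>space lam\<close>.\<close>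

lemma AE_kernel_part_0:
  assumes L: "L \<in> measurable lam (subprob_algebra borel)"
    and le: "\<And>x B. B \<in> sets borel \<Longrightarrow> emeasure (L x) B \<le> emeasure (K x) B"
    and G: "G \<in> sets (lam \<Otimes>\<^sub>M borel)" "emeasure pair\<mu> (space pair\<mu> - G) = 0"
    and sections: "\<And>x. sets (L x) = sets borel \<Longrightarrow> emeasure (L x) (Pair x -` G) = 0"
  shows "AE x in \<nu>. emeasure (L x) UNIV = 0"
  using AE_concentrated[OF G] AE_space
proof eventually_elim
  case (elim x)
  then have s: "sets (L x) = sets borel" using subprob_kernel_space[OF L] by simp
  have S: "Pair x -` G \<in> sets borel" using G(1) by (rule section_sets)
  have "emeasure (L x) (UNIV - Pair x -` G) = 0"
    using le[of "UNIV - Pair x -` G" x] elim(1) S by (simp add: Compl_eq_Diff_UNIV[symmetric])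
  with s S sections[OF s] show ?case by (rule emeasure_UNIV_eq_0)
qed

text \<open>Collecting the atoms of all \<open>L x\<close> gives a set with countable sections, null
  for the copula when \<gamma> has no atoms. Hence almost every \<open>K x\<close>, and with it
  \<open>L x\<close>, ignores the very atoms that carry \<open>L x\<close>.\<close>

lemma AE_discrete_part_0:
  assumes L: "L \<in> measurable lam (subprob_algebra borel)" and disc: "\<And>x. discrete_measure (L x)"
    and le: "\<And>x B. B \<in> sets borel \<Longrightarrow> emeasure (L x) B \<le> emeasure (K x) B"
    and atomless: "\<And>t. emeasure \<gamma> {t} = 0"
  shows "AE x in \<nu>. emeasure (L x) UNIV = 0"
proof -
  define G where "G = {p \<in> space (lam \<Otimes>\<^sub>M borel). emeasure (L (fst p)) {snd p} \<noteq> 0}"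
  have "(\<lambda>p. emeasure (L (fst p)) {snd p}) \<in> borel_measurable (lam \<Otimes>\<^sub>M borel)"
  proof (rule emeasure_measurable_subprob_algebra2)
    \<comment> \<open>The singletons vary measurably with p because their graph is a
      diagonal.\<close>
    have "(SIGMA p:space (lam \<Otimes>\<^sub>M borel). {snd p})
        = {q \<in> space ((lam \<Otimes>\<^sub>M borel) \<Otimes>\<^sub>M borel). snd (fst q) = (snd q :: real)}"
      by (auto simp: space_pair_measure)
    also have "\<dots> \<in> sets ((lam \<Otimes>\<^sub>M borel) \<Otimes>\<^sub>M borel)" by measurable
    finally show "(SIGMA p:space (lam \<Otimes>\<^sub>M borel). {snd p :: real}) \<in> sets ((lam \<Otimes>\<^sub>M borel) \<Otimes>\<^sub>M borel)" .
    show "(\<lambda>p. L (fst p)) \<in> measurable (lam \<Otimes>\<^sub>M borel) (subprob_algebra borel)"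
      using L by measurable
  qed
  then have G: "G \<in> sets (lam \<Otimes>\<^sub>M borel)" unfolding G_def by measurable
  have fin: "sets (L x) = sets borel" "finite_measure (L x)" if "x \<in> space lam" for x
    using subprob_kernel_space[OF L that] by (auto simp: subprob_space_def)
  have sec: "Pair x -` G = (if x \<in> space lam then {y. emeasure (L x) {y} \<noteq> 0} else {})" for x
    by (auto simp: G_def space_pair_measure)
  have "countable (Pair x -` G)" for x
    using discrete_measure_support(1)[OF disc fin] by (simp add: sec)
  from pair\<mu>_null_if_countable_sections[OF G this atomless] have "emeasure pair\<mu> G = 0" .
  from AE_section_null[OF G this] AE_space show ?thesis
  proof eventually_elim
    case (elim x)
    then have x: "x \<in> space lam" by simp
    have S: "Pair x -` G \<in> sets borel" using G by (rule section_sets)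
    show ?case
    proof (rule emeasure_UNIV_eq_0[OF fin(1)[OF x] S])
      show "emeasure (L x) (Pair x -` G) = 0" using le[OF S, of x] elim(1) by simp
      show "emeasure (L x) (UNIV - Pair x -` G) = 0"
        using discrete_measure_support(2)[OF disc fin[OF x]] x by (simp add: sec)
    qed
  qed
qed

section \<open>Absolute continuity of the copula and of its kernel\<close>

lemma pair\<mu>_abs_cont:
  assumes "abs_cont_measure \<gamma>"
  shows "absolutely_continuous (lam \<Otimes>\<^sub>M lborel) pair\<mu>"
  unfolding absolutely_continuous_def
proof
  fix G :: "((nat \<Rightarrow> real) \<times> real) set"
  assume "G \<in> null_sets (lam \<Otimes>\<^sub>M lborel)"
  then have G: "G \<in> sets (lam \<Otimes>\<^sub>M lborel)" "emeasure (lam \<Otimes>\<^sub>M lborel) G = 0" by auto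
  have s: "sets (lam \<Otimes>\<^sub>M lborel) = sets (lam \<Otimes>\<^sub>M (borel :: real measure))"
    by (intro sets_pair_measure_cong) simp_all
  then have G': "G \<in> sets (lam \<Otimes>\<^sub>M borel)" using G by simp
  have meas: "(\<lambda>x. emeasure lborel (Pair x -` G)) \<in> borel_measurable lam"
    using G(1) by (rule lborel.measurable_emeasure_Pair)
  have "AE x in lam. emeasure lborel (Pair x -` G) = 0"
    using G meas by (subst nn_integral_0_iff_AE[symmetric]) (auto simp: lborel.emeasure_pair_measure_alt)
  then have AE\<nu>: "AE x in \<nu>. emeasure lborel (Pair x -` G) = 0"
    unfolding \<nu>_def by (subst AE_density) auto
  \<comment> \<open>A null set has null sections only for almost every x, while the section
    criterion asks for all x. The exceptional x are cut out; the cylinder over them is null because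
    the marginal has a density.\<close>
  define N where "N = {x \<in> space lam. emeasure lborel (Pair x -` G) \<noteq> 0}"
  have N: "N \<in> sets lam" unfolding N_def using meas by measurable
  have "N \<in> null_sets \<nu>"
    using AE\<nu> N by (subst AE_iff_null_sets) (auto simp: N_def elim: eventually_mono)
  have "emeasure pair\<mu> (N \<times> UNIV) = (\<integral>\<^sup>+x\<in>N. emeasure (K x) UNIV \<partial>\<nu>)"
    using N by (intro pair\<mu>_rectangle) auto
  also have "\<dots> = 0"
    using \<open>N \<in> null_sets \<nu>\<close> by (rule nn_integral_null_set)
  finally have 1: "emeasure pair\<mu> (N \<times> UNIV) = 0" .
  have G0: "G - N \<times> UNIV \<in> sets (lam \<Otimes>\<^sub>M borel)" using G' N by auto
  have 2: "emeasure pair\<mu> (G - N \<times> UNIV) = 0"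
  proof (rule pair\<mu>_null_if_negligible_sections[OF G0])
    show "absolutely_continuous lborel \<gamma>" using assms by (simp add: abs_cont_measure_def)
    fix u
    show "negligible (Pair u -` (G - N \<times> UNIV))"
    proof (cases "u \<in> space lam \<and> u \<notin> N")
      case True
      then have "Pair u -` G \<in> null_sets lborel"
        using section_sets[OF G', of u] by (auto simp: N_def null_sets_def)
      then have "negligible (Pair u -` G)"
        by (simp add: negligible_iff_null_sets null_sets_completionI)
      then show ?thesis by (rule negligible_subset) auto
    next
      case False
      then have "Pair u -` (G - N \<times> UNIV) = {}"
        using sets.sets_into_space[OF G'] by (auto simp: space_pair_measure)
      then show ?thesis by simp
    qed
  qed
  have "(G - N \<times> UNIV) \<union> N \<times> UNIV \<in> null_sets pair\<mu>"
    using 1 2 G0 N by (intro null_sets.Un) (auto simp: null_sets_def)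
  then show "G \<in> null_sets pair\<mu>"
    by (rule null_sets_subset) (use G' in auto)
qed

text \<open>Inserting the last coordinate identifies \<open>lam \<Otimes>\<^sub>M lborel\<close>
  with \<open>lam'\<close>, which carries the result for \<open>pair\<mu>\<close> back to the
  cube.\<close>

lemma \<mu>_abs_cont:
  assumes "abs_cont_measure \<gamma>"
  shows "absolutely_continuous lam' \<mu>"
  unfolding absolutely_continuous_def
proof
  interpret product_sigma_finite "\<lambda>_::nat. lborel :: real measure" by standard
  fix A assume "A \<in> null_sets lam'"
  then have A: "A \<in> sets lam'" "emeasure lam' A = 0" by auto
  define G where "G = (\<lambda>(u, y). u(n := y)) -` A \<inter> space (lam \<Otimes>\<^sub>M borel)"
  have G: "G \<in> sets (lam \<Otimes>\<^sub>M borel)" unfolding G_def by (rule measurable_sets[OF measurable_add_last A(1)])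
  have s: "sets (lam \<Otimes>\<^sub>M lborel) = sets (lam \<Otimes>\<^sub>M (borel :: real measure))"
    by (intro sets_pair_measure_cong) simp_all
  have "emeasure lam' A = (\<integral>\<^sup>+z. indicator A z \<partial>Pi\<^sub>M (insert n {..<n}) (\<lambda>_. lborel))"
    using A(1) by (simp add: lessThan_Suc)
  also have "\<dots> = (\<integral>\<^sup>+u. \<integral>\<^sup>+y. indicator A (u(n := y)) \<partial>lborel \<partial>lam)"
    using A(1) by (intro product_nn_integral_insert) (auto simp: lessThan_Suc)
  also have "\<dots> = (\<integral>\<^sup>+u. emeasure lborel (Pair u -` G) \<partial>lam)"
  proof (rule nn_integral_cong)
    fix u assume "u \<in> space lam"
    then have "indicator A (u(n := y)) = (indicator (Pair u -` G) y :: ennreal)" for y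
      by (auto simp: G_def indicator_def space_pair_measure)
    then show "(\<integral>\<^sup>+y. indicator A (u(n := y)) \<partial>lborel) = emeasure lborel (Pair u -` G)"
      using section_sets[OF G, of u] by simp
  qed
  also have "\<dots> = emeasure (lam \<Otimes>\<^sub>M lborel) G"
    using G s by (subst lborel.emeasure_pair_measure_alt) auto
  finally have "G \<in> null_sets (lam \<Otimes>\<^sub>M lborel)" using A G s by (simp add: null_sets_def)
  then have "emeasure pair\<mu> G = 0"
    using pair\<mu>_abs_cont[OF assms] by (auto simp: absolutely_continuous_def)
  moreover have "emeasure pair\<mu> G = emeasure \<mu> ((\<lambda>z. (restrict z {..<n}, z n)) -` G \<inter> space \<mu>)"
    unfolding pair\<mu>_def by (rule emeasure_distr[OF measurable_split_\<mu> G])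
  moreover have "(\<lambda>z. (restrict z {..<n}, z n)) -` G \<inter> space \<mu> = A"
  proof -
    have "(restrict z {..<n})(n := z n) = z" if "z \<in> space \<mu>" for z
      using that by (auto simp: space_\<mu> space_PiM PiE_iff extensional_def fun_eq_iff)
    moreover have "A \<subseteq> space \<mu>" using sets.sets_into_space[OF A(1)] by (simp add: space_\<mu>)
    ultimately show ?thesis by (auto simp: G_def space_pair_measure space_PiM)
  qed
  ultimately show "A \<in> null_sets \<mu>" using A by (simp add: null_sets_def)
qed

text \<open>For almost every x, \<open>K x\<close> scaled by \<open>c x\<close> has the section of a
  joint density f as its density. The quantifier over null sets stands inside the almost-everywhere
  statement, so B may depend on x.\<close>

lemma AE_kernel_abs_cont:
  assumes "abs_cont_measure \<gamma>"
  shows "AE x in \<nu>. \<forall>B\<in>null_sets lborel. emeasure (K x) B = 0"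
proof -
  interpret P: pair_sigma_finite lam "lborel :: real measure" by standard
  have s: "sets (lam \<Otimes>\<^sub>M lborel) = sets (lam \<Otimes>\<^sub>M (borel :: real measure))"
    by (intro sets_pair_measure_cong) simp_all
  have "\<exists>f\<in>borel_measurable (lam \<Otimes>\<^sub>M lborel). density (lam \<Otimes>\<^sub>M lborel) f = pair\<mu>"
    by (rule P.Radon_Nikodym[OF pair\<mu>_abs_cont[OF assms]]) (simp add: s)
  then obtain f where f[measurable]: "f \<in> borel_measurable (lam \<Otimes>\<^sub>M lborel)" and f_eq: "density (lam \<Otimes>\<^sub>M lborel) f = pair\<mu>"
    by blast
  have eq: "AE x in lam. emeasure (K x) B * ennreal (c x) = (\<integral>\<^sup>+y\<in>B. f (x, y) \<partial>lborel)"
    if B[measurable]: "B \<in> sets borel" for B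
  proof (rule lam.density_unique2)
    have KB: "(\<lambda>x. emeasure (K x) B) \<in> borel_measurable lam"
      by (rule measurable_compose[OF K_subprob measurable_emeasure_subprob_algebra[OF B]])
    then show "(\<lambda>x. emeasure (K x) B * ennreal (c x)) \<in> borel_measurable lam" by measurable
    show "(\<lambda>x. \<integral>\<^sup>+y\<in>B. f (x, y) \<partial>lborel) \<in> borel_measurable lam" by measurable
    fix A assume A[measurable]: "A \<in> sets lam"
    have "(\<integral>\<^sup>+x\<in>A. (emeasure (K x) B * ennreal (c x)) \<partial>lam) = (\<integral>\<^sup>+x. ennreal (c x) * (emeasure (K x) B * indicator A x) \<partial>lam)"
      by (intro nn_integral_cong) (simp add: ac_simps)
    also have "\<dots> = (\<integral>\<^sup>+x\<in>A. emeasure (K x) B \<partial>\<nu>)"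
      unfolding \<nu>_def using KB by (subst nn_integral_density) auto
    also have "\<dots> = emeasure pair\<mu> (A \<times> B)" by (rule pair\<mu>_rectangle[OF A B, symmetric])
    also have "\<dots> = (\<integral>\<^sup>+p. f p * indicator (A \<times> B) p \<partial>(lam \<Otimes>\<^sub>M lborel))"
      unfolding f_eq[symmetric] by (rule emeasure_density) auto
    also have "\<dots> = (\<integral>\<^sup>+x. \<integral>\<^sup>+y. f (x, y) * indicator (A \<times> B) (x, y) \<partial>lborel \<partial>lam)"
      by (rule lborel.nn_integral_fst[symmetric]) measurable
    also have "\<dots> = (\<integral>\<^sup>+x\<in>A. (\<integral>\<^sup>+y\<in>B. f (x, y) \<partial>lborel) \<partial>lam)"
      by (intro nn_integral_cong) (auto simp: indicator_def)
    finally show "(\<integral>\<^sup>+x\<in>A. (emeasure (K x) B * ennreal (c x)) \<partial>lam) = (\<integral>\<^sup>+x\<in>A. (\<integral>\<^sup>+y\<in>B. f (x, y) \<partial>lborel) \<partial>lam)" .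
  qed
  \<comment> \<open>The exceptional set of \<open>eq\<close> depends on B; for countably many rays
    one exceptional set serves them all.\<close>
  have "AE x in lam. \<forall>q::rat. emeasure (K x) {real_of_rat q <..} * ennreal (c x) = (\<integral>\<^sup>+y\<in>{real_of_rat q <..}. f (x, y) \<partial>lborel)"
    by (subst AE_all_countable) (auto intro!: eq)
  \<comment> \<open>Under \<nu> almost every x has \<open>c x > 0\<close>, so comparing the measures
    scaled by \<open>c x\<close> loses nothing.\<close>
  with AE_space have "AE x in lam. 0 < ennreal (c x) \<longrightarrow> (\<forall>B\<in>null_sets lborel. emeasure (K x) B = 0)"
  proof (eventually_elim, intro impI ballI)
    fix x :: "nat \<Rightarrow> real" and B :: "real set"
    assume x: "x \<in> space lam" and cx: "0 < ennreal (c x)" and B: "B \<in> null_sets lborel"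
      and rat: "\<forall>q::rat. emeasure (K x) {real_of_rat q <..} * ennreal (c x) = (\<integral>\<^sup>+y\<in>{real_of_rat q <..}. f (x, y) \<partial>lborel)"
    interpret Kx: prob_space "K x" using K_space[OF x] by simp
    have Ks: "sets (K x) = sets borel" using K_space[OF x] by simp
    have fx: "(\<lambda>y. f (x, y)) \<in> borel_measurable lborel" using f x by measurable
    have "scale_measure (ennreal (c x)) (K x) = density lborel (\<lambda>y. f (x, y))"
    proof (rule measure_eqI_rat_greaterThan)
      show "emeasure (scale_measure (ennreal (c x)) (K x)) UNIV \<noteq> \<infinity>"
        using Kx.emeasure_finite by (simp add: ennreal_mult_eq_top_iff)
      show "emeasure (scale_measure (ennreal (c x)) (K x)) {real_of_rat q <..} = emeasure (density lborel (\<lambda>y. f (x, y))) {real_of_rat q <..}" for q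
        using rat fx by (subst emeasure_density) (auto simp: mult.commute)
    qed (simp_all add: Ks)
    then have "ennreal (c x) * emeasure (K x) B = emeasure (density lborel (\<lambda>y. f (x, y))) B"
      by (metis emeasure_scale_measure)
    also have "\<dots> = 0"
      using absolutely_continuousI_density[OF fx] B by (auto simp: absolutely_continuous_def)
    finally show "emeasure (K x) B = 0" using cx by auto
  qed
  then show ?thesis unfolding \<nu>_def by (subst AE_density) auto
qed

text \<open>The carrier Z is chosen separately for each x, with no measurability in x; this is
  harmless since \<open>K x\<close> ignores all null sets. It serves discrete and singular parts
  alike.\<close>

lemma AE_null_supported_part_0:
  assumes "abs_cont_measure \<gamma>" and L: "L \<in> measurable lam (subprob_algebra borel)"
    and le: "\<And>x B. B \<in> sets borel \<Longrightarrow> emeasure (L x) B \<le> emeasure (K x) B"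
    and supp: "\<And>x. \<exists>Z\<in>null_sets lborel. emeasure (L x) (UNIV - Z) = 0"
  shows "AE x in \<nu>. emeasure (L x) UNIV = 0"
  using AE_kernel_abs_cont[OF assms(1)] AE_space
proof eventually_elim
  case (elim x)
  obtain Z where Z: "Z \<in> null_sets lborel" "emeasure (L x) (UNIV - Z) = 0" using supp by blast
  show ?case
  proof (rule emeasure_UNIV_eq_0[OF _ _ _ Z(2)])
    show "sets (L x) = sets borel" using subprob_kernel_space[OF L] elim by simp
    show "Z \<in> sets borel" using Z by auto
    then show "emeasure (L x) Z = 0" using le[of Z x] elim(1) Z(1) by simp
  qed
qed

end

theorem theorem5p10:
  fixes d :: nat
    and \<psi> :: "real \<Rightarrow> real"
    and \<gamma> :: "real measure"
    and \<mu> :: "(nat \<Rightarrow> real) measure"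
    and c :: "(nat \<Rightarrow> real) \<Rightarrow> real"
    and K Kdis Ksing Kabs :: "(nat \<Rightarrow> real) \<Rightarrow> real measure"
  assumes "d \<ge> 3"
    and "arch_generator \<psi>"
    and "copula_measure_of d (arch_copula d \<psi>) \<mu>"
    and "williamson_measure d \<psi> \<gamma>"
    and "c \<in> borel_measurable (Pi\<^sub>M {..<d-1} (\<lambda>_. lborel))" and "\<forall>x. 0 \<le> c x"
    and "distr \<mu> (Pi\<^sub>M {..<d-1} (\<lambda>_. lborel)) (\<lambda>z. restrict z {..<d-1})
           = density (Pi\<^sub>M {..<d-1} (\<lambda>_. lborel)) (\<lambda>x. ennreal (c x))"
    and "markov_kernel_of d \<mu> K"
    and "kernel_decomposition d K Kdis Ksing Kabs"
  shows "(abs_cont_measure \<gamma> \<longrightarrow>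
            mu_part d Kabs c (unit_cube d) = 1 \<and> absolutely_continuous (Pi\<^sub>M {..<d} (\<lambda>_. lborel)) \<mu>)
       \<and> (discrete_measure \<gamma> \<longrightarrow> mu_part d Kdis c (unit_cube d) = 1)
       \<and> (singular_no_atoms \<gamma> \<longrightarrow> mu_part d Ksing c (unit_cube d) = 1)"
proof -
  define n where "n = d - 1"
  have d: "d = Suc n" and n: "2 \<le> n" using assms(1) by (auto simp: n_def)
  interpret copula_kernel n \<psi> \<gamma> \<mu> c K
    using assms n unfolding d diff_Suc_1 by unfold_locales auto
  have Kdis: "Kdis \<in> measurable lam (subprob_algebra borel)"
    and Ksing: "Ksing \<in> measurable lam (subprob_algebra borel)"
    and Kabs: "Kabs \<in> measurable lam (subprob_algebra borel)"
    and decomp: "\<And>x B. B \<in> sets borel \<Longrightarrow>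
      emeasure (K x) B = emeasure (Kdis x) B + emeasure (Ksing x) B + emeasure (Kabs x) B"
    and dis: "\<And>x. discrete_measure (Kdis x)" and sing: "\<And>x. singular_no_atoms (Ksing x)"
    and abs: "\<And>x. abs_cont_measure (Kabs x)"
    using assms(9) unfolding d diff_Suc_1 kernel_decomposition_def by auto
  have le: "emeasure (Kdis x) B \<le> emeasure (K x) B" "emeasure (Ksing x) B \<le> emeasure (K x) B"
    "emeasure (Kabs x) B \<le> emeasure (K x) B" if "B \<in> sets borel" for x B
    using decomp[OF that, of x] by (auto simp: add_increasing add_increasing2)
  show ?thesis unfolding d
  proof (intro conjI impI)
    assume ac: "abs_cont_measure \<gamma>"
    show "absolutely_continuous lam' \<mu>" using ac by (rule \<mu>_abs_cont)
    have "AE x in \<nu>. emeasure (Kdis x) UNIV = 0"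
    proof (rule AE_null_supported_part_0[OF ac Kdis le(1)])
      fix x
      obtain S where "countable S" "emeasure (Kdis x) (UNIV - S) = 0"
        using dis[of x] by (auto simp: discrete_measure_def)
      then show "\<exists>Z\<in>null_sets lborel. emeasure (Kdis x) (UNIV - Z) = 0"
        using countable_imp_null_set_lborel by blast
    qed
    moreover have "AE x in \<nu>. emeasure (Ksing x) UNIV = 0"
    proof (rule AE_null_supported_part_0[OF ac Ksing le(2)])
      show "\<exists>Z\<in>null_sets lborel. emeasure (Ksing x) (UNIV - Z) = 0" for x
        using sing[of x] by (auto simp: singular_no_atoms_def null_sets_def)
    qed
    ultimately show "mu_part (Suc n) Kabs c (unit_cube (Suc n)) = 1"
      using decomp Kdis Ksing Kabs by (intro mu_part_cube[of Kabs Kdis Ksing]) (auto simp: ac_simps)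
  next
    assume "discrete_measure \<gamma>"
    then obtain S where S: "countable S" "emeasure \<gamma> (UNIV - S) = 0" by (auto simp: discrete_measure_def)
    have "S \<in> sets borel" by (rule sets.countable[OF _ S(1)]) simp
    from pair\<mu>_concentrated[OF this S(2)] obtain G where
      G: "G \<in> sets (lam \<Otimes>\<^sub>M borel)" "emeasure pair\<mu> (space pair\<mu> - G) = 0"
      and sec: "\<And>u. \<exists>s. Pair u -` G \<subseteq> {1} \<union> \<psi> ` (((+) (- s) ` inverse ` (S - {0})) \<inter> {0<..})"
      by blast
    have cnt: "countable (Pair u -` G)" for u
    proof -
      obtain s where "Pair u -` G \<subseteq> {1} \<union> \<psi> ` (((+) (- s) ` inverse ` (S - {0})) \<inter> {0<..})"
        using sec by blast
      moreover have "countable ({1} \<union> \<psi> ` (((+) (- s) ` inverse ` (S - {0})) \<inter> {0<..}))"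
        using S(1) by auto
      ultimately show ?thesis by (rule countable_subset)
    qed
    \<comment> \<open>One G removes both other parts: its countable sections are ignored by atomless
      and by absolutely continuous measures.\<close>
    have "AE x in \<nu>. emeasure (Ksing x) UNIV = 0"
      using singular_countable_0[OF sing _ cnt] by (intro AE_kernel_part_0[OF Ksing le(2) G])
    moreover have "AE x in \<nu>. emeasure (Kabs x) UNIV = 0"
      using abs_cont_negligible_0[OF abs negligible_if_countable[OF cnt] section_sets[OF G(1)]]
      by (intro AE_kernel_part_0[OF Kabs le(3) G])
    ultimately show "mu_part (Suc n) Kdis c (unit_cube (Suc n)) = 1"
      using decomp Kdis Ksing Kabs by (intro mu_part_cube[of Kdis Ksing Kabs]) auto
  next
    assume \<gamma>_sing: "singular_no_atoms \<gamma>"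
    then obtain Z where Z: "Z \<in> sets borel" "emeasure lborel Z = 0" "emeasure \<gamma> (UNIV - Z) = 0"
      by (auto simp: singular_no_atoms_def)
    have "Z \<in> null_sets lborel" using Z by auto
    then have negZ: "negligible Z" by (simp add: negligible_iff_null_sets null_sets_completionI)
    from pair\<mu>_concentrated[OF Z(1,3)] obtain G where
      G: "G \<in> sets (lam \<Otimes>\<^sub>M borel)" "emeasure pair\<mu> (space pair\<mu> - G) = 0"
      and sec: "\<And>u. \<exists>s. Pair u -` G \<subseteq> {1} \<union> \<psi> ` (((+) (- s) ` inverse ` (Z - {0})) \<inter> {0<..})"
      by blast
    have neg: "negligible (Pair u -` G)" for u
    proof -
      obtain s where "Pair u -` G \<subseteq> {1} \<union> \<psi> ` (((+) (- s) ` inverse ` (Z - {0})) \<inter> {0<..})"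
        using sec by blast
      moreover have "negligible ({1} \<union> \<psi> ` (((+) (- s) ` inverse ` (Z - {0})) \<inter> {0<..}))"
        using negZ by (intro negligible_Un negligible_sing negligible_psi_image negligible_Int disjI1
          negligible_translation negligible_inverse_image negligible_diff) auto
      ultimately show ?thesis by (metis negligible_subset)
    qed
    have "AE x in \<nu>. emeasure (Kabs x) UNIV = 0"
      using abs_cont_negligible_0[OF abs neg section_sets[OF G(1)]]
      by (intro AE_kernel_part_0[OF Kabs le(3) G])
    \<comment> \<open>Null sections do not exclude atoms, so here the absence of atoms of \<gamma>
      is used instead of the set G.\<close>
    moreover have "AE x in \<nu>. emeasure (Kdis x) UNIV = 0"
      using \<gamma>_sing by (intro AE_discrete_part_0[OF Kdis dis le(1)]) (auto simp: singular_no_atoms_def)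
    ultimately show "mu_part (Suc n) Ksing c (unit_cube (Suc n)) = 1"
      using decomp Kdis Ksing Kabs by (intro mu_part_cube[of Ksing Kdis Kabs]) (auto simp: ac_simps)
  qed
qed

end
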